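(* Let $(X,\mu)$ be a computable probability space and $n\ge 1$. If $x\in X$ is Schnorr $n$-random, then for any $\Pi^0_n$ set $A$ (not necessarily containing $x$) such that $\mu(A)>0$ and $\mu(A)$ is $\emptyset^{(n-1)}$-computable, and any computable ergodic measure-preserving transformation $T:\subseteq X\to X$ with $x\in\operatorname{dom}T$, we have $T^k(x)\in A$ for some $k>0$.
   Context: Uniformity: a sequence of objects has a property (whose definition involves an index in $\mathbb N$) uniformly if a computable function produces suitable indices. $\emptyset^{(m)}$ denotes the $m$-th Turing jump of $\emptyset$. A computable metric space is a triple $(X,d,S)$ where $(X,d)$ is a complete separable metric space, $S=(s_i)_i$ is a dense sequence in $X$, and $d(s_i,s_j)$ is a computable real number uniformly in $i,j$. With $(q_j)_j$ a fixed enumeration of the positive rationals and $\langle\cdot,\cdot\rangle$ the standard pairing function, the ideal balls are $B_{\langle i,j\rangle}=\{x\in X: d(x,s_i)<q_j\}$. A set $U\subseteq X$ is $\Sigma^0_1$ if $U=\bigcup_{i\in W}B_i$ for some c.e. $W\subseteq\mathbb N$ (its index is an index of $W$). A set is $\Pi^0_n$ if its complement is $\Sigma^0_n$. A set is $\Sigma^0_{n+1}$ if it equals $\bigcup_{i\in W}(X\setminus U^n_i)$ for some c.e. $W\subseteq\mathbb N$, where $U^n_i$ is the $i$-th $\Sigma^0_n$ set. For $D\subseteq X$, a subset of $D$ is $\Sigma^0_n$ in $D$ if it is the intersection of $D$ with a $\Sigma^0_n$ subset of $X$. A computable probability space $(X,\mu)$ is a computable metric space with a Borel probability measure $\mu$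 such that $\mu(\bigcup_{i\in F}B_i)$ is lower-semicomputable uniformly in finite $F\subseteq\mathbb N$. A Schnorr $n$-test is a sequence $(U_k)_k$ of uniformly $\Sigma^0_n$ sets with $\mu(U_k)\le 2^{-k}$ for all $k$ and $\mu(U_k)$ uniformly $\emptyset^{(n-1)}$-computable in $k$. A point $x$ is Schnorr $n$-random if $x\notin\bigcap_kU_k$ for every Schnorr $n$-test. A measure-preserving transformation is a partial Borel measurable map $T:\subseteq X\to X$ such that $\mu(T^{-1}(B))=\mu(B)$ for every Borel $B$ (so $\operatorname{dom}T$ has full measure) and $x\in\operatorname{dom}T$ implies $T(x)\in\operatorname{dom}T$. It is computable if the sets $T^{-1}(B_i)$ are uniformly $\Sigma^0_1$ in $\operatorname{dom}T$. It is ergodic if every Borel $B$ with $T^{-1}(B)=B$ has measure $0$ or $1$. *)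

theory Defs
  imports "HOL-Probability.Probability_Measure" "HOL-Library.Nat_Bijection"
begin

section \<open>Oracle computability\<close>

text \<open>
  Partial recursive functions with an oracle, in one argument: several arguments are packed with
  Cantor's pairing function \<^const>\<open>prod_encode\<close>. In \<open>Prec\<close>, the argument is
  \<open>(parameter, recursion variable)\<close>, and the step function is applied to
  \<open>(parameter, (stage, previous value))\<close>.
\<close>

datatype prog =
    Zero
  | Succ
  | Fst
  | Snd
  | Query
  | Pair prog prog
  | Comp prog prog
  | Prec prog prog
  | Mu prog

primrec run :: "nat set \<Rightarrow> prog \<Rightarrow> nat \<rightharpoonup> nat" where
  "run A Zero = (\<lambda>x. Some 0)"
| "run A Succ = (\<lambda>x. Some (Suc x))"
| "run A Fst = (\<lambda>x. Some (fst (prod_decode x)))"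
| "run A Snd = (\<lambda>x. Some (snd (prod_decode x)))"
| "run A Query = (\<lambda>x. Some (if x \<in> A then 1 else 0))"
| "run A (Pair p q) =
     (\<lambda>x. Option.bind (run A p x) (\<lambda>u. Option.bind (run A q x) (\<lambda>v. Some (prod_encode (u, v)))))"
| "run A (Comp p q) = (\<lambda>x. Option.bind (run A q x) (run A p))"
| "run A (Prec p q) =
     (\<lambda>x. rec_nat (run A p (fst (prod_decode x)))
       (\<lambda>m r. Option.bind r (\<lambda>v. run A q (prod_encode (fst (prod_decode x), prod_encode (m, v)))))
       (snd (prod_decode x)))"
| "run A (Mu p) =
     (\<lambda>x. if \<exists>n. run A p (prod_encode (x, n)) = Some 0 \<and>
               (\<forall>m<n. run A p (prod_encode (x, m)) \<noteq> None)
          then Some (LEAST n. run A p (prod_encode (x, n)) = Some 0) else None)"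

primrec prog_number :: "prog \<Rightarrow> nat" where
  "prog_number Zero = 0"
| "prog_number Succ = 1"
| "prog_number Fst = 2"
| "prog_number Snd = 3"
| "prog_number Query = 4"
| "prog_number (Pair p q) = 4 * prod_encode (prog_number p, prog_number q) + 5"
| "prog_number (Comp p q) = 4 * prod_encode (prog_number p, prog_number q) + 6"
| "prog_number (Prec p q) = 4 * prod_encode (prog_number p, prog_number q) + 7"
| "prog_number (Mu p) = 4 * prog_number p + 8"

lemma bij_prog_number: "bij prog_number"
proof (rule bijI)
  have "prog_number p = prog_number q \<Longrightarrow> p = q" for p q
  proof (induction p arbitrary: q)
    case (Pair p1 p2) then show ?case by (cases q) (auto, presburger+)
  next
    case (Comp p1 p2) then show ?case by (cases q) (auto, presburger+)
  next
    case (Prec p1 p2) then show ?case by (cases q) (auto, presburger+)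
  next
    case (Mu p) then show ?case by (cases q) (auto, presburger+)
  qed (case_tac q; simp)+
  then show "inj prog_number" by (rule injI)
  have "\<exists>p. prog_number p = n" for n
  proof (induction n rule: less_induct)
    case (less n)
    have pairs: "\<exists>p q. prod_encode (prog_number p, prog_number q) = m" if "m < n" for m
    proof -
      obtain a b where m: "m = prod_encode (a, b)"
        by (metis prod_decode_inverse surj_pair)
      then have "a < n" "b < n"
        using that le_prod_encode_1[of a b] le_prod_encode_2[of b a] by simp_all
      with less.IH m show ?thesis by metis
    qed
    have "n < 5 \<or> (\<exists>m. n = 4 * m + 5) \<or> (\<exists>m. n = 4 * m + 6) \<or> (\<exists>m. n = 4 * m + 7) \<or>
        (\<exists>m. n = 4 * m + 8)"
      by presburger
    then consider "n < 5" | m where "n = 4 * m + 5" | m where "n = 4 * m + 6"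
      | m where "n = 4 * m + 7" | m where "n = 4 * m + 8"
      by blast
    then show ?case
    proof cases
      case 1
      then have "n = 0 \<or> n = 1 \<or> n = 2 \<or> n = 3 \<or> n = 4" by auto
      then show ?thesis using prog_number.simps(1-5) by metis
    next
      case (2 m)
      with pairs[of m] obtain p q where "prod_encode (prog_number p, prog_number q) = m" by auto
      with 2 show ?thesis by (intro exI[of _ "Pair p q"]) simp
    next
      case (3 m)
      with pairs[of m] obtain p q where "prod_encode (prog_number p, prog_number q) = m" by auto
      with 3 show ?thesis by (intro exI[of _ "Comp p q"]) simp
    next
      case (4 m)
      with pairs[of m] obtain p q where "prod_encode (prog_number p, prog_number q) = m" by auto
      with 4 show ?thesis by (intro exI[of _ "Prec p q"]) simp
    next
      case (5 m)
      with less.IH[of m] obtain p where "prog_number p = m" by auto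
      with 5 show ?thesis by (intro exI[of _ "Mu p"]) simp
    qed
  qed
  then show "surj prog_number" by (metis surjI)
qed

definition phi :: "nat set \<Rightarrow> nat \<Rightarrow> nat \<rightharpoonup> nat" where
  "phi A e = run A (inv prog_number e)"

definition computable :: "(nat \<Rightarrow> nat) \<Rightarrow> bool" where
  "computable f \<longleftrightarrow> (\<exists>e. \<forall>x. phi {} e x = Some (f x))"

definition ce_set :: "nat \<Rightarrow> nat set" where
  "ce_set e = dom (phi {} e)"

definition jump :: "nat set \<Rightarrow> nat set" where
  "jump A = {e. phi A e e \<noteq> None}"

definition zero_jump :: "nat \<Rightarrow> nat set" where
  "zero_jump m = (jump ^^ m) {}"

text \<open>\<open>P k e\<close> reads: \<open>e\<close> is an index witnessing the property for the \<open>k\<close>-th object.\<close>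

definition uniformly :: "(nat \<Rightarrow> nat \<Rightarrow> bool) \<Rightarrow> bool" where
  "uniformly P \<longleftrightarrow> (\<exists>f. computable f \<and> (\<forall>k. P k (f k)))"


section \<open>Computable reals\<close>

definition rat_enum :: "nat \<Rightarrow> real" where
  "rat_enum k = (case prod_decode k of (i, c) \<Rightarrow> real_of_int (int_decode i) / real (Suc c))"

definition pos_rat_enum :: "nat \<Rightarrow> real" where
  "pos_rat_enum k = (case prod_decode k of (a, b) \<Rightarrow> real (Suc a) / real (Suc b))"

definition computable_real_index :: "nat set \<Rightarrow> real \<Rightarrow> nat \<Rightarrow> bool" where
  "computable_real_index A r e \<longleftrightarrow>
     (\<forall>m. \<exists>j. phi A e m = Some j \<and> \<bar>rat_enum j - r\<bar> \<le> (1/2) ^ m)"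

definition computable_real_in :: "nat set \<Rightarrow> real \<Rightarrow> bool" where
  "computable_real_in A r \<longleftrightarrow> (\<exists>e. computable_real_index A r e)"

definition lower_semicomputable_index :: "real \<Rightarrow> nat \<Rightarrow> bool" where
  "lower_semicomputable_index r e \<longleftrightarrow> ce_set e = {j. rat_enum j < r}"


section \<open>Computable metric and probability spaces\<close>

text \<open>The underlying complete separable metric space is the type itself.\<close>

definition computable_metric_space :: "(nat \<Rightarrow> 'a::polish_space) \<Rightarrow> bool" where
  "computable_metric_space s \<longleftrightarrow>
     closure (range s) = UNIV \<and>
     uniformly (\<lambda>k. computable_real_index {} (case prod_decode k of (i, j) \<Rightarrow> dist (s i) (s j)))"

definition ideal_ball :: "(nat \<Rightarrow> 'a::polish_space) \<Rightarrow> nat \<Rightarrow> 'a set" where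
  "ideal_ball s k = (case prod_decode k of (i, j) \<Rightarrow> {x. dist x (s i) < pos_rat_enum j})"

text \<open>The set with index \<open>e\<close> at level \<open>n\<close>. Levels start at 1; level 0 is a dummy.\<close>

fun Sigma_set :: "(nat \<Rightarrow> 'a::polish_space) \<Rightarrow> nat \<Rightarrow> nat \<Rightarrow> 'a set" where
  "Sigma_set s 0 e = {}"
| "Sigma_set s (Suc 0) e = (\<Union>i\<in>ce_set e. ideal_ball s i)"
| "Sigma_set s (Suc (Suc n)) e = (\<Union>i\<in>ce_set e. - Sigma_set s (Suc n) i)"

definition is_Pi :: "(nat \<Rightarrow> 'a::polish_space) \<Rightarrow> nat \<Rightarrow> 'a set \<Rightarrow> bool" where
  "is_Pi s n A \<longleftrightarrow> (\<exists>e. - A = Sigma_set s n e)"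

text \<open>\<^const>\<open>set_decode\<close> is the canonical enumeration of the finite sets of natural numbers.\<close>

definition computable_probability_space ::
    "(nat \<Rightarrow> 'a::polish_space) \<Rightarrow> 'a measure \<Rightarrow> bool" where
  "computable_probability_space s M \<longleftrightarrow>
     computable_metric_space s \<and> prob_space M \<and> sets M = sets borel \<and>
     uniformly (\<lambda>k. lower_semicomputable_index (measure M (\<Union>i\<in>set_decode k. ideal_ball s i)))"

definition Schnorr_test ::
    "(nat \<Rightarrow> 'a::polish_space) \<Rightarrow> 'a measure \<Rightarrow> nat \<Rightarrow> (nat \<Rightarrow> 'a set) \<Rightarrow> bool" where
  "Schnorr_test s M n U \<longleftrightarrow>
     uniformly (\<lambda>k e. U k = Sigma_set s n e) \<and>
     (\<forall>k. measure M (U k) \<le> (1/2) ^ k) \<and>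
     uniformly (\<lambda>k. computable_real_index (zero_jump (n - 1)) (measure M (U k)))"

definition Schnorr_random ::
    "(nat \<Rightarrow> 'a::polish_space) \<Rightarrow> 'a measure \<Rightarrow> nat \<Rightarrow> 'a \<Rightarrow> bool" where
  "Schnorr_random s M n x \<longleftrightarrow> (\<forall>U. Schnorr_test s M n U \<longrightarrow> x \<notin> (\<Inter>k. U k))"


section \<open>Partial transformations\<close>

text \<open>
  A partial map is a pair of its domain \<open>D\<close> and a total function \<open>T\<close> whose values outside \<open>D\<close>
  are irrelevant; its preimage of \<open>B\<close> is \<open>T -` B \<inter> D\<close>.
\<close>

definition measure_preserving_on :: "'a::polish_space measure \<Rightarrow> 'a set \<Rightarrow> ('a \<Rightarrow> 'a) \<Rightarrow> bool" where
  "measure_preserving_on M D T \<longleftrightarrow>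
     (\<forall>B\<in>sets borel. T -` B \<inter> D \<in> sets borel \<and> measure M (T -` B \<inter> D) = measure M B) \<and>
     T ` D \<subseteq> D"

definition computable_map_on ::
    "(nat \<Rightarrow> 'a::polish_space) \<Rightarrow> 'a set \<Rightarrow> ('a \<Rightarrow> 'a) \<Rightarrow> bool" where
  "computable_map_on s D T \<longleftrightarrow>
     uniformly (\<lambda>i e. T -` ideal_ball s i \<inter> D = D \<inter> Sigma_set s 1 e)"

definition ergodic_on :: "'a::polish_space measure \<Rightarrow> 'a set \<Rightarrow> ('a \<Rightarrow> 'a) \<Rightarrow> bool" where
  "ergodic_on M D T \<longleftrightarrow>
     (\<forall>B\<in>sets borel. T -` B \<inter> D = B \<longrightarrow> measure M B = 0 \<or> measure M B = 1)"

end

theory Submission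
  imports Defs
begin

text \<open>
  Let \<open>U\<close> be the complement of \<open>A\<close>, let \<open>W\<^sub>0 = X\<close> and let \<open>W\<^sub>m\<^sub>+\<^sub>1\<close> be the preimage of
  \<open>U \<inter> W\<^sub>m\<close>. A point of the domain lies in \<open>W\<^sub>m\<close> iff its orbit avoids \<open>A\<close> at the times \<open>1, \<dots>, m\<close>.
  The points returning to \<open>A\<close> infinitely often form an invariant set of measure at least \<open>\<mu>(A)\<close>,
  which has full measure by ergodicity, so \<open>\<mu>(W\<^sub>m)\<close> tends to 0. By invariance of the measure,
  \<open>\<mu>(W\<^sub>m\<^sub>+\<^sub>1) = \<mu>(U \<inter> W\<^sub>m) = \<mu>(U) + \<mu>(W\<^sub>m) - \<mu>(U \<union> W\<^sub>m)\<close>, and summing this up,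
  \<open>\<mu>(W\<^sub>m) + (\<Sum>i<m. \<mu>(U \<union> W\<^sub>i)) = 1 + m * \<mu>(U)\<close>. All terms on the left are measures of
  sets at level \<open>n\<close> and hence lower semicomputable in the \<open>(n - 1)\<close>-th jump, while their sum is
  computable in it; hence so are the terms. Therefore the jump computes some \<open>f\<close> with
  \<open>\<mu>(W\<^bsub>f k\<^esub>) \<le> (1/2)^k\<close>. Since the set that is \<open>X\<close> if \<open>m = f k\<close> and empty otherwise is uniformly
  at level \<open>n\<close> (Post's theorem), the sets \<open>W\<^bsub>f k\<^esub> = (\<Union>m. W\<^sub>m \<inter> [m = f k])\<close> form a Schnorr test,
  which captures every point whose orbit avoids \<open>A\<close>.
\<close>

section \<open>Relative computability\<close>

abbreviation pfst :: "nat \<Rightarrow> nat" where "pfst z \<equiv> fst (prod_decode z)"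
abbreviation psnd :: "nat \<Rightarrow> nat" where "psnd z \<equiv> snd (prod_decode z)"

text \<open>Speaks of programs and leaves their numbers aside, so closure properties follow by
  composing constructors; \<open>phi_prog_number\<close> and \<open>computable_iff\<close> lead back
  to indices.\<close>

definition comp_in :: "nat set \<Rightarrow> (nat \<Rightarrow> nat) \<Rightarrow> bool" where
  "comp_in B f \<longleftrightarrow> (\<exists>p. \<forall>x. run B p x = Some (f x))"

definition dec_in :: "nat set \<Rightarrow> (nat \<Rightarrow> bool) \<Rightarrow> bool" where
  "dec_in B P \<longleftrightarrow> comp_in B (\<lambda>x. of_bool (P x))"

text \<open>Enumerability as projection of a decidable relation: closure under conjunction,
  disjunction and bounded quantifiers then only concerns witnesses. Machines enter through
  \<open>ce_in_index\<close>.\<close>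

definition ce_in :: "nat set \<Rightarrow> (nat \<Rightarrow> bool) \<Rightarrow> bool" where
  "ce_in B P \<longleftrightarrow>
     (\<exists>D. dec_in B (\<lambda>z. D (pfst z) (psnd z)) \<and> (\<forall>x. P x \<longleftrightarrow> (\<exists>w. D x w)))"

lemma comp_in_id: "comp_in B (\<lambda>x. x)"
  unfolding comp_in_def by (rule exI[of _ "Pair Fst Snd"]) simp

lemma comp_in_comp:
  assumes "comp_in B h" "comp_in B f"
  shows "comp_in B (\<lambda>x. h (f x))"
proof -
  obtain p q where "\<forall>x. run B p x = Some (h x)" "\<forall>x. run B q x = Some (f x)"
    using assms unfolding comp_in_def by auto
  then show ?thesis unfolding comp_in_def by (intro exI[of _ "Comp p q"]) simp
qed

lemma comp_in_Suc: "comp_in B f \<Longrightarrow> comp_in B (\<lambda>x. Suc (f x))"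
  by (rule comp_in_comp) (auto simp: comp_in_def intro: exI[of _ Succ])

lemma comp_in_const: "comp_in B (\<lambda>x. c)"
proof (induction c)
  case 0
  show ?case unfolding comp_in_def by (rule exI[of _ Zero]) simp
next
  case (Suc c)
  then show ?case by (rule comp_in_Suc)
qed

lemma comp_in_pfst: "comp_in B f \<Longrightarrow> comp_in B (\<lambda>x. pfst (f x))"
  by (rule comp_in_comp) (auto simp: comp_in_def intro: exI[of _ Fst])

lemma comp_in_psnd: "comp_in B f \<Longrightarrow> comp_in B (\<lambda>x. psnd (f x))"
  by (rule comp_in_comp) (auto simp: comp_in_def intro: exI[of _ Snd])

lemma comp_in_pair:
  assumes "comp_in B f" "comp_in B g"
  shows "comp_in B (\<lambda>x. prod_encode (f x, g x))"
proof -
  obtain p q where "\<forall>x. run B p x = Some (f x)" "\<forall>x. run B q x = Some (g x)"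
    using assms unfolding comp_in_def by auto
  then show ?thesis unfolding comp_in_def by (intro exI[of _ "Pair p q"]) simp
qed

text \<open>The argument \<open>x\<close> itself serves as the parameter of \<open>Prec\<close>, so
  that the base, the step and the number of stages may all depend on it.\<close>

lemma comp_in_rec:
  assumes "comp_in B f" "comp_in B (\<lambda>z. g (pfst z) (pfst (psnd z)) (psnd (psnd z)))" "comp_in B h"
  shows "comp_in B (\<lambda>x. rec_nat (f x) (\<lambda>m r. g x m r) (h x))"
proof -
  obtain p where p: "\<forall>x. run B p x = Some (f x)"
    using assms(1) unfolding comp_in_def by auto
  obtain q where q: "\<forall>z. run B q z = Some (g (pfst z) (pfst (psnd z)) (psnd (psnd z)))"
    using assms(2) unfolding comp_in_def by auto
  have "run B (Prec p q) (prod_encode (x, k)) = Some (rec_nat (f x) (\<lambda>m r. g x m r) k)" for x k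
    by (induction k) (auto simp: p q)
  then have "comp_in B (\<lambda>z. rec_nat (f (pfst z)) (\<lambda>m r. g (pfst z) m r) (psnd z))"
    unfolding comp_in_def
    using prod_decode_inverse by (intro exI[of _ "Prec p q"] allI) (metis prod.collapse)
  from comp_in_comp[OF this comp_in_pair[OF comp_in_id assms(3)]] show ?thesis by simp
qed

section \<open>Arithmetic functions\<close>

lemma comp_in_add:
  assumes "comp_in B f" "comp_in B g"
  shows "comp_in B (\<lambda>x. f x + g x)"
proof -
  have "rec_nat a (\<lambda>m r. Suc r) b = a + b" for a b :: nat by (induction b) auto
  with comp_in_rec[of B f "\<lambda>x m r. Suc r" g] show ?thesis
    by (simp add: assms comp_in_Suc comp_in_psnd comp_in_id)
qed

lemma comp_in_diff:
  assumes "comp_in B f" "comp_in B g"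
  shows "comp_in B (\<lambda>x. f x - g x)"
proof -
  \<comment> \<open>Returning the stage counter and dropping the previous value yields the
    predecessor.\<close>
  have "rec_nat 0 (\<lambda>m r. m) b = b - 1" for b :: nat by (cases b) auto
  with comp_in_rec[of B "\<lambda>_. 0" "\<lambda>x m r. m" "\<lambda>x. x"]
  have pred: "comp_in B (\<lambda>x. x - 1)"
    by (simp add: comp_in_pfst comp_in_psnd comp_in_id comp_in_const)
  have "rec_nat a (\<lambda>m r. r - 1) b = a - b" for a b :: nat by (induction b) auto
  with comp_in_rec[of B f "\<lambda>x m r. r - 1" g]
  show ?thesis using comp_in_comp[OF pred]
    by (simp add: assms comp_in_psnd comp_in_id)
qed

lemma comp_in_mult:
  assumes "comp_in B f" "comp_in B g"
  shows "comp_in B (\<lambda>x. f x * g x)"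
proof -
  have "rec_nat 0 (\<lambda>m r. r + a) b = a * b" for a b :: nat by (induction b) auto
  with comp_in_rec[of B "\<lambda>_. 0" "\<lambda>x m r. r + f x" g] show ?thesis
    by (simp add: assms comp_in_psnd comp_in_pfst comp_in_id comp_in_add comp_in_const
        comp_in_comp[OF assms(1)])
qed

lemma comp_in_power:
  assumes "comp_in B f" "comp_in B g"
  shows "comp_in B (\<lambda>x. f x ^ g x)"
proof -
  have "rec_nat 1 (\<lambda>m r. r * a) b = a ^ b" for a b :: nat by (induction b) auto
  with comp_in_rec[of B "\<lambda>_. 1" "\<lambda>x m r. r * f x" g] show ?thesis
    by (simp add: assms comp_in_psnd comp_in_pfst comp_in_id comp_in_mult comp_in_const
        comp_in_comp[OF assms(1)])
qed

lemma comp_in_sum: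
  assumes "comp_in B (\<lambda>z. f (pfst z) (psnd z))" "comp_in B g"
  shows "comp_in B (\<lambda>x. \<Sum>i<g x. f x i)"
proof -
  have "rec_nat 0 (\<lambda>m r. r + h m) b = (\<Sum>i<b. h i)" for h :: "nat \<Rightarrow> nat" and b
    by (induction b) auto
  moreover have "comp_in B (\<lambda>z. f (pfst z) (pfst (psnd z)))"
    using comp_in_comp[OF assms(1), of "\<lambda>z. prod_encode (pfst z, pfst (psnd z))"]
    by (simp add: comp_in_psnd comp_in_pfst comp_in_id comp_in_pair)
  ultimately show ?thesis
    using comp_in_rec[of B "\<lambda>_. 0" "\<lambda>x m r. r + f x m" g, OF comp_in_const
        comp_in_add[OF comp_in_psnd[OF comp_in_psnd[OF comp_in_id]]] assms(2)]
    by simp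
qed

section \<open>Decidable predicates and bounded search\<close>

lemma dec_in_comp: "dec_in B P \<Longrightarrow> comp_in B f \<Longrightarrow> dec_in B (\<lambda>x. P (f x))"
  unfolding dec_in_def by (rule comp_in_comp)

lemma dec_in_comp2:
  assumes "dec_in B (\<lambda>z. P (pfst z) (psnd z))" "comp_in B f" "comp_in B g"
  shows "dec_in B (\<lambda>x. P (f x) (g x))"
  using dec_in_comp[OF assms(1) comp_in_pair[OF assms(2,3)]] by simp

lemma dec_in_le:
  assumes "comp_in B f" "comp_in B g"
  shows "dec_in B (\<lambda>x. f x \<le> g x)"
proof -
  have "1 - (a - b) = of_bool (a \<le> b)" for a b :: nat by auto
  with comp_in_diff[OF comp_in_const[of B 1] comp_in_diff[OF assms]] show ?thesis
    unfolding dec_in_def by simp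
qed

lemma dec_in_not: "dec_in B P \<Longrightarrow> dec_in B (\<lambda>x. \<not> P x)"
proof -
  assume "dec_in B P"
  then have "comp_in B (\<lambda>x. 1 - of_bool (P x))"
    unfolding dec_in_def by (rule comp_in_diff[OF comp_in_const])
  moreover have "1 - of_bool c = (of_bool (\<not> c) :: nat)" for c by simp
  ultimately show ?thesis unfolding dec_in_def by (simp only:)
qed

lemma dec_in_conj: "dec_in B P \<Longrightarrow> dec_in B Q \<Longrightarrow> dec_in B (\<lambda>x. P x \<and> Q x)"
  unfolding dec_in_def of_bool_conj by (rule comp_in_mult)

lemma dec_in_disj:
  assumes "dec_in B P" "dec_in B Q"
  shows "dec_in B (\<lambda>x. P x \<or> Q x)"
  using dec_in_not[OF dec_in_conj[OF assms[THEN dec_in_not]]] by simp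

lemma dec_in_imp: "dec_in B P \<Longrightarrow> dec_in B Q \<Longrightarrow> dec_in B (\<lambda>x. P x \<longrightarrow> Q x)"
  unfolding imp_conv_disj by (intro dec_in_disj dec_in_not)

lemma dec_in_less: "comp_in B f \<Longrightarrow> comp_in B g \<Longrightarrow> dec_in B (\<lambda>x. f x < g x)"
  unfolding Suc_le_eq[symmetric] by (intro dec_in_le comp_in_Suc)

lemma dec_in_eq:
  assumes "comp_in B f" "comp_in B g"
  shows "dec_in B (\<lambda>x. f x = g x)"
proof -
  have "dec_in B (\<lambda>x. f x \<le> g x \<and> g x \<le> f x)" by (intro dec_in_conj dec_in_le assms)
  then show ?thesis by (simp flip: eq_iff)
qed

lemma dec_in_const: "dec_in B (\<lambda>x. c)"
  unfolding dec_in_def by (rule comp_in_const)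

lemma comp_in_if:
  assumes "dec_in B P" "comp_in B f" "comp_in B g"
  shows "comp_in B (\<lambda>x. if P x then f x else g x)"
proof -
  have "comp_in B (\<lambda>x. of_bool (P x) * f x + of_bool (\<not> P x) * g x)"
    using assms dec_in_not[OF assms(1)] unfolding dec_in_def
    by (intro comp_in_add comp_in_mult)
  moreover have "(\<lambda>x. of_bool (P x) * f x + of_bool (\<not> P x) * g x) =
      (\<lambda>x. if P x then f x else g x)"
    by auto
  ultimately show ?thesis by simp
qed

lemma dec_in_all_less:
  assumes "dec_in B (\<lambda>z. P (pfst z) (psnd z))" "comp_in B b"
  shows "dec_in B (\<lambda>x. \<forall>i<b x. P x i)"
proof -
  have "comp_in B (\<lambda>x. \<Sum>i<b x. of_bool (\<not> P x i))"
    using dec_in_not[OF assms(1)] assms(2) unfolding dec_in_def by (rule comp_in_sum)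
  then have "dec_in B (\<lambda>x. (\<Sum>i<b x. of_bool (\<not> P x i) :: nat) = 0)"
    by (rule dec_in_eq[OF _ comp_in_const])
  then show ?thesis by (simp add: Ball_def flip: of_bool_not_iff del: sum_of_bool_eq)
qed

lemma dec_in_ex_less:
  assumes "dec_in B (\<lambda>z. P (pfst z) (psnd z))" "comp_in B b"
  shows "dec_in B (\<lambda>x. \<exists>i<b x. P x i)"
  using dec_in_not[OF dec_in_all_less[OF dec_in_not[OF assms(1)] assms(2)]] by simp

lemma comp_in_of_bool: "dec_in B P \<Longrightarrow> comp_in B (\<lambda>x. of_bool (P x))"
  unfolding dec_in_def .

text \<open>The quotient counts the positive multiples of the divisor up to the dividend. The guard
  \<open>b \<noteq> 0\<close> gives the value 0 for division by 0.\<close>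

lemma comp_in_div:
  assumes "comp_in B f" "comp_in B g"
  shows "comp_in B (\<lambda>x. f x div g x)"
proof -
  have "(\<Sum>i<a. of_bool (b \<noteq> 0 \<and> Suc i * b \<le> a)) = a div b" for a b :: nat
  proof (cases "b = 0")
    case False
    have "(\<Sum>i<a. of_bool (Suc i * b \<le> a)) = (\<Sum>i\<in>{..<a} \<inter> {i. Suc i * b \<le> a}. 1::nat)"
      by (simp only: of_bool_def) (subst sum.inter_restrict, auto intro: sum.cong)
    also have "{..<a} \<inter> {i. Suc i * b \<le> a} = {..<a div b}"
    proof -
      have *: "Suc i * b \<le> a \<longleftrightarrow> i < a div b" for i
        using False less_eq_div_iff_mult_less_eq[of b "Suc i" a] by (simp add: Suc_le_eq)
      have "i < a div b \<Longrightarrow> i < a" for i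
        by (meson div_le_dividend less_le_trans)
      with * show ?thesis by auto
    qed
    finally show ?thesis using False by simp
  qed simp
  moreover have "comp_in B (\<lambda>x. \<Sum>i<f x. of_bool (g x \<noteq> 0 \<and> Suc i * g x \<le> f x))"
    by (intro comp_in_sum comp_in_of_bool dec_in_conj dec_in_not dec_in_eq dec_in_le comp_in_mult
        comp_in_Suc comp_in_psnd comp_in_id comp_in_const comp_in_comp[OF assms(1)]
        comp_in_comp[OF assms(2)] comp_in_pfst)
  ultimately show ?thesis by simp
qed

lemma comp_in_mod:
  assumes "comp_in B f" "comp_in B g"
  shows "comp_in B (\<lambda>x. f x mod g x)"
  using comp_in_diff[OF assms(1) comp_in_mult[OF comp_in_div[OF assms] assms(2)]]
  by (simp add: minus_div_mult_eq_mod)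

lemma dec_in_even: "comp_in B f \<Longrightarrow> dec_in B (\<lambda>x. even (f x))"
  using dec_in_eq[OF comp_in_mod[OF _ comp_in_const[of B 2]] comp_in_const[of B 0]]
  by (simp add: even_iff_mod_2_eq_zero)

lemma dec_in_set_decode:
  "comp_in B f \<Longrightarrow> comp_in B g \<Longrightarrow> dec_in B (\<lambda>x. f x \<in> set_decode (g x))"
  unfolding set_decode_def mem_Collect_eq
  by (intro dec_in_not dec_in_even comp_in_div comp_in_power comp_in_const)

lemma dec_in_oracle: "comp_in B f \<Longrightarrow> dec_in B (\<lambda>x. f x \<in> B)"
  by (rule dec_in_comp[where P = "\<lambda>x. x \<in> B"])
    (auto simp: comp_in_def dec_in_def of_bool_def intro: exI[of _ Query])

lemmas comp_intros = comp_in_id comp_in_const comp_in_Suc comp_in_pfst comp_in_psnd comp_in_pair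
  comp_in_add comp_in_diff comp_in_mult comp_in_power comp_in_sum comp_in_if comp_in_of_bool
  comp_in_div comp_in_mod
  dec_in_const dec_in_le dec_in_less dec_in_eq dec_in_not dec_in_conj dec_in_disj dec_in_imp
  dec_in_all_less dec_in_ex_less dec_in_even dec_in_set_decode dec_in_oracle

section \<open>Computably enumerable predicates\<close>

lemma ce_in_dec: "dec_in B P \<Longrightarrow> ce_in B P"
  unfolding ce_in_def
  by (rule exI[of _ "\<lambda>x w. P x"]) (simp add: dec_in_comp[OF _ comp_in_pfst[OF comp_in_id]])

lemma ce_in_comp:
  assumes "ce_in B P" "comp_in B f"
  shows "ce_in B (\<lambda>x. P (f x))"
proof -
  obtain D where D: "dec_in B (\<lambda>z. D (pfst z) (psnd z))" "\<And>x. P x \<longleftrightarrow> (\<exists>w. D x w)"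
    using assms(1) unfolding ce_in_def by auto
  show ?thesis unfolding ce_in_def
    by (rule exI[of _ "\<lambda>x w. D (f x) w"])
      (auto simp: D(2) intro!: dec_in_comp2[OF D(1)] comp_intros comp_in_comp[OF assms(2)])
qed

lemma ce_in_comp2:
  assumes "ce_in B (\<lambda>z. P (pfst z) (psnd z))" "comp_in B f" "comp_in B g"
  shows "ce_in B (\<lambda>x. P (f x) (g x))"
  using ce_in_comp[OF assms(1) comp_in_pair[OF assms(2,3)]] by simp

lemma ce_in_ex:
  assumes "ce_in B (\<lambda>z. P (pfst z) (psnd z))"
  shows "ce_in B (\<lambda>x. \<exists>y. P x y)"
proof -
  obtain D where D: "dec_in B (\<lambda>z. D (pfst z) (psnd z))"
    "\<And>z. P (pfst z) (psnd z) \<longleftrightarrow> (\<exists>w. D z w)"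
    using assms unfolding ce_in_def by auto
  have P: "P x y \<longleftrightarrow> (\<exists>w. D (prod_encode (x, y)) w)" for x y
    using D(2)[of "prod_encode (x, y)"] by simp
  have "(\<exists>y. P x y) \<longleftrightarrow> (\<exists>w. D (prod_encode (x, pfst w)) (psnd w))" for x
    unfolding P by (metis fst_conv prod_encode_inverse snd_conv)
  moreover have "dec_in B (\<lambda>z. D (prod_encode (pfst z, pfst (psnd z))) (psnd (psnd z)))"
    by (intro dec_in_comp2[OF D(1)] comp_intros)
  ultimately show ?thesis unfolding ce_in_def
    by (intro exI[of _ "\<lambda>x w. D (prod_encode (x, pfst w)) (psnd w)"]) simp
qed

lemma ce_in_conj:
  assumes "ce_in B P" "ce_in B Q"
  shows "ce_in B (\<lambda>x. P x \<and> Q x)"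
proof -
  obtain D where D: "dec_in B (\<lambda>z. D (pfst z) (psnd z))" "\<And>x. P x \<longleftrightarrow> (\<exists>w. D x w)"
    using assms(1) unfolding ce_in_def by auto
  obtain E where E: "dec_in B (\<lambda>z. E (pfst z) (psnd z))" "\<And>x. Q x \<longleftrightarrow> (\<exists>w. E x w)"
    using assms(2) unfolding ce_in_def by auto
  have "ce_in B (\<lambda>x. \<exists>v w. D x v \<and> E x w)"
    by (intro ce_in_ex ce_in_dec dec_in_conj dec_in_comp2[OF D(1)] dec_in_comp2[OF E(1)]
        comp_intros)
  then show ?thesis by (simp add: D E)
qed

lemma ce_in_disj:
  assumes "ce_in B P" "ce_in B Q"
  shows "ce_in B (\<lambda>x. P x \<or> Q x)"
proof -
  obtain D where D: "dec_in B (\<lambda>z. D (pfst z) (psnd z))" "\<And>x. P x \<longleftrightarrow> (\<exists>w. D x w)"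
    using assms(1) unfolding ce_in_def by auto
  obtain E where E: "dec_in B (\<lambda>z. E (pfst z) (psnd z))" "\<And>x. Q x \<longleftrightarrow> (\<exists>w. E x w)"
    using assms(2) unfolding ce_in_def by auto
  have "ce_in B (\<lambda>x. \<exists>w. D x w \<or> E x w)"
    by (intro ce_in_ex ce_in_dec dec_in_disj dec_in_comp2[OF D(1)] dec_in_comp2[OF E(1)]
        comp_intros)
  then show ?thesis by (simp add: D E ex_disj_distrib)
qed

text \<open>The sum of finitely many witnesses bounds them all. This moves an unbounded search out
  of a bounded universal quantifier and leaves a decidable matrix.\<close>

lemma collect_bounded:
  "(\<forall>i<b. \<exists>w. P i w) \<longleftrightarrow> (\<exists>W. \<forall>i<b. \<exists>w<W. P i w)" for b :: nat and P :: "nat \<Rightarrow> nat \<Rightarrow> bool"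
proof
  assume "\<forall>i<b. \<exists>w. P i w"
  then obtain f where f: "\<And>i. i < b \<Longrightarrow> P i (f i)" by metis
  have "f i < Suc (\<Sum>i<b. f i)" if "i < b" for i
    using that by (simp add: less_Suc_eq_le member_le_sum)
  with f show "\<exists>W. \<forall>i<b. \<exists>w<W. P i w" by blast
qed blast

lemma ce_in_all_less:
  assumes "ce_in B (\<lambda>z. P (pfst z) (psnd z))" "comp_in B b"
  shows "ce_in B (\<lambda>x. \<forall>i<b x. P x i)"
proof -
  obtain D where D: "dec_in B (\<lambda>z. D (pfst z) (psnd z))"
    "\<And>z. P (pfst z) (psnd z) \<longleftrightarrow> (\<exists>w. D z w)"
    using assms unfolding ce_in_def by auto
  have P: "P x y \<longleftrightarrow> (\<exists>w. D (prod_encode (x, y)) w)" for x y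
    using D(2)[of "prod_encode (x, y)"] by simp
  have "ce_in B (\<lambda>x. \<exists>W. \<forall>i<b x. \<exists>w<W. D (prod_encode (x, i)) w)"
    by (intro ce_in_ex ce_in_dec dec_in_all_less dec_in_ex_less dec_in_comp2[OF D(1)]
        comp_intros comp_in_comp[OF assms(2)])
  then show ?thesis by (simp add: P flip: collect_bounded)
qed

lemma ce_in_imp: "dec_in B P \<Longrightarrow> ce_in B Q \<Longrightarrow> ce_in B (\<lambda>x. P x \<longrightarrow> Q x)"
  unfolding imp_conv_disj by (intro ce_in_disj) (rule ce_in_dec[OF dec_in_not])

lemma ce_in_ex_less:
  assumes "ce_in B (\<lambda>z. P (pfst z) (psnd z))" "comp_in B b"
  shows "ce_in B (\<lambda>x. \<exists>i<b x. P x i)"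
  by (intro ce_in_ex ce_in_conj ce_in_dec dec_in_less assms(1) comp_intros comp_in_comp[OF assms(2)])

text \<open>\<open>Mu\<close> looks for the value 0, so the program it is applied to decides the
  negation of \<open>D\<close>; as that program is total, the definedness condition of
  \<open>Mu\<close> always holds.\<close>

lemma dec_in_Mu:
  assumes "dec_in B (\<lambda>z. D (pfst z) (psnd z))"
  obtains p where "\<And>x. run B p x = (if \<exists>w. D x w then Some (LEAST w. D x w) else None)"
proof -
  have "comp_in B (\<lambda>z. of_bool (\<not> D (pfst z) (psnd z)))"
    using dec_in_not[OF assms] unfolding dec_in_def .
  then obtain p where p: "\<And>z. run B p z = Some (of_bool (\<not> D (pfst z) (psnd z)))"
    unfolding comp_in_def by auto
  show thesis
    by (rule that[of "Mu p"]) (simp add: p)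
qed

text \<open>Search for a value together with the witness that it is correct, coded as one pair, and
  return the first component.\<close>

lemma ce_in_select:
  assumes "ce_in B (\<lambda>z. P (pfst z) (psnd z))" "\<And>x. \<exists>y. P x y"
  obtains f where "comp_in B f" "\<And>x. P x (f x)"
proof -
  obtain D where D: "dec_in B (\<lambda>z. D (pfst z) (psnd z))"
    "\<And>z. P (pfst z) (psnd z) \<longleftrightarrow> (\<exists>w. D z w)"
    using assms unfolding ce_in_def by auto
  define E where "E x w = D (prod_encode (x, pfst w)) (psnd w)" for x w
  have "dec_in B (\<lambda>z. E (pfst z) (psnd z))"
    unfolding E_def by (intro dec_in_comp2[OF D(1)] comp_intros)
  then obtain p where p: "\<And>x. run B p x = (if \<exists>w. E x w then Some (LEAST w. E x w) else None)"
    by (rule dec_in_Mu) auto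
  have ex: "\<exists>w. E x w" for x
  proof -
    obtain y where "P x y" using assms(2) by blast
    then obtain w where "D (prod_encode (x, y)) w" using D(2)[of "prod_encode (x, y)"] by auto
    then show ?thesis unfolding E_def by (intro exI[of _ "prod_encode (y, w)"]) simp
  qed
  then have "comp_in B (\<lambda>x. LEAST w. E x w)" unfolding comp_in_def using p by auto
  moreover have "P x (pfst (LEAST w. E x w))" for x
    using LeastI_ex[OF ex[of x]] D(2)[of "prod_encode (x, pfst (LEAST w. E x w))"]
    unfolding E_def by auto
  ultimately show thesis using that comp_in_pfst by blast
qed

section \<open>Indices\<close>

lemma phi_prog_number [simp]: "phi B (prog_number p) = run B p"
  unfolding phi_def by (simp add: bij_prog_number bij_is_inj)

lemma computable_iff: "computable f \<longleftrightarrow> comp_in {} f"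
proof
  assume "comp_in {} f"
  then show "computable f" unfolding computable_def comp_in_def by (metis phi_prog_number)
qed (auto simp: computable_def comp_in_def phi_def)

text \<open>Answering every query by 0 hardwires the empty oracle, so that computations without
  oracle keep their results relative to every oracle.\<close>

primrec query_free :: "prog \<Rightarrow> prog" where
  "query_free Zero = Zero"
| "query_free Succ = Succ"
| "query_free Fst = Fst"
| "query_free Snd = Snd"
| "query_free Query = Zero"
| "query_free (Pair p q) = Pair (query_free p) (query_free q)"
| "query_free (Comp p q) = Comp (query_free p) (query_free q)"
| "query_free (Prec p q) = Prec (query_free p) (query_free q)"
| "query_free (Mu p) = Mu (query_free p)"

lemma run_query_free: "run B (query_free p) = run {} p"
  by (induction p) auto

lemma comp_in_empty: "comp_in {} f \<Longrightarrow> comp_in B f"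
  unfolding comp_in_def by (metis run_query_free)

lemma dec_in_empty: "dec_in {} P \<Longrightarrow> dec_in B P"
  unfolding dec_in_def by (rule comp_in_empty)

lemma ce_in_empty: "ce_in {} P \<Longrightarrow> ce_in B P"
  unfolding ce_in_def using dec_in_empty by blast

section \<open>Parametrisation of indices\<close>

primrec const_prog :: "nat \<Rightarrow> prog" where
  "const_prog 0 = Zero"
| "const_prog (Suc c) = Comp Succ (const_prog c)"

lemma run_const_prog [simp]: "run B (const_prog c) x = Some c"
  by (induction c) auto

text \<open>The program \<open>p\<close> is composed with one that pairs the constant
  \<open>k\<close> with the input. This is pure syntax, so the same \<open>h\<close>, computable
  without oracle, serves all oracles \<open>B\<close> at once.\<close>

lemma smn:
  obtains h where "comp_in {} h" "\<And>B k x. phi B (h k) x = run B p (prod_encode (k, x))"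
proof -
  define h where "h k = prog_number (Comp p (Pair (const_prog k) (Pair Fst Snd)))" for k
  \<comment> \<open>1 is the number of \<open>Succ\<close> and 6 the offset of \<open>Comp\<close>,
    so the number of \<open>const_prog k\<close> arises by primitive recursion.\<close>
  have c: "prog_number (const_prog k) = rec_nat 0 (\<lambda>m r. 4 * prod_encode (1, r) + 6) k" for k
    by (induction k) auto
  have "comp_in {} h"
    unfolding h_def prog_number.simps c by (intro comp_intros comp_in_rec)
  moreover have "phi B (h k) x = run B p (prod_encode (k, x))" for B k x
    by (simp add: h_def del: prog_number.simps)
  ultimately show thesis using that by blast
qed

lemma ce_in_index:
  assumes "ce_in B (\<lambda>z. P (pfst z) (psnd z))"
  obtains h where "comp_in {} h" "\<And>k. dom (phi B (h k)) = {i. P k i}"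
proof -
  obtain D where D: "dec_in B (\<lambda>z. D (pfst z) (psnd z))"
    "\<And>z. P (pfst z) (psnd z) \<longleftrightarrow> (\<exists>w. D z w)"
    using assms unfolding ce_in_def by auto
  from D(1) obtain p where
    p: "\<And>x. run B p x = (if \<exists>w. D x w then Some (LEAST w. D x w) else None)"
    by (rule dec_in_Mu) auto
  obtain h where h: "comp_in {} h" "\<And>B k x. phi B (h k) x = run B p (prod_encode (k, x))"
    using smn by blast
  have "dom (phi B (h k)) = {i. P k i}" for k
  proof -
    have "phi B (h k) i \<noteq> None \<longleftrightarrow> P k i" for i
      unfolding h p using D(2)[of "prod_encode (k, i)"] by simp
    then show ?thesis by (simp add: dom_def)
  qed
  with h(1) show thesis using that by blast
qed

lemma ce_set_index:
  assumes "ce_in {} (\<lambda>z. P (pfst z) (psnd z))"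
  obtains h where "comp_in {} h" "\<And>k. ce_set (h k) = {i. P k i}"
  using ce_in_index[OF assms] unfolding ce_set_def by blast

lemma comp_in_index:
  assumes "comp_in B (\<lambda>z. f (pfst z) (psnd z))"
  obtains h where "comp_in {} h" "\<And>k m. phi B (h k) m = Some (f k m)"
proof -
  obtain p where p: "\<And>z. run B p z = Some (f (pfst z) (psnd z))"
    using assms unfolding comp_in_def by auto
  obtain h where h: "comp_in {} h" "\<And>B k x. phi B (h k) x = run B p (prod_encode (k, x))"
    using smn by blast
  then show thesis using that by (simp add: p)
qed

text \<open>The program with index \<open>h k\<close> ignores its input and halts iff
  \<open>P k\<close> holds. Halting on its own index is thus equivalent to \<open>P k\<close>, and
  one query to the jump settles it.\<close>

lemma dec_in_jump:
  assumes "ce_in B P"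
  shows "dec_in (jump B) P"
proof -
  have "ce_in B (\<lambda>z. P (pfst z))" by (intro ce_in_comp[OF assms] comp_intros)
  from ce_in_index[of B "\<lambda>k i. P k", OF this]
  obtain h where h: "comp_in {} h" "\<And>k. dom (phi B (h k)) = {i. P k}" by blast
  have "P = (\<lambda>k. h k \<in> jump B)"
    using h(2) unfolding jump_def dom_def by (auto simp: set_eq_iff)
  with dec_in_oracle[OF comp_in_empty[OF h(1)], of "jump B"] show ?thesis by (simp only:)
qed

section \<open>Certificates of computations\<close>

definition triple :: "nat \<Rightarrow> nat \<Rightarrow> nat \<Rightarrow> nat" where
  "triple e x y = prod_encode (e, prod_encode (x, y))"

text \<open>
  The triple \<open>(e, x, y)\<close> claims that the program with number \<open>e\<close> maps \<open>x\<close> to \<open>y\<close>. For \<open>5 \<le> e\<close>, the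
  remainder of \<open>e - 5\<close> modulo 4 is the constructor and the quotient encodes the subprograms. Oracle
  answers (\<open>e = 4\<close>) are left open here and checked separately by \<open>oracle_cert\<close>.
\<close>

definition derived :: "nat set \<Rightarrow> nat \<Rightarrow> nat \<Rightarrow> nat \<Rightarrow> bool" where
  "derived S e x y \<longleftrightarrow>
     e = 0 \<and> y = 0 \<or>
     e = 1 \<and> y = Suc x \<or>
     e = 2 \<and> y = pfst x \<or>
     e = 3 \<and> y = psnd x \<or>
     e = 4 \<and> (y = 0 \<or> y = 1) \<or>
     5 \<le> e \<and> (e - 5) mod 4 = 0 \<and>
       triple (pfst ((e - 5) div 4)) x (pfst y) \<in> S \<and>
       triple (psnd ((e - 5) div 4)) x (psnd y) \<in> S \<or>
     5 \<le> e \<and> (e - 5) mod 4 = 1 \<and>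
       (\<exists>u. triple (psnd ((e - 5) div 4)) x u \<in> S \<and> triple (pfst ((e - 5) div 4)) u y \<in> S) \<or>
     5 \<le> e \<and> (e - 5) mod 4 = 2 \<and> psnd x = 0 \<and>
       triple (pfst ((e - 5) div 4)) (pfst x) y \<in> S \<or>
     5 \<le> e \<and> (e - 5) mod 4 = 2 \<and> psnd x \<noteq> 0 \<and>
       (\<exists>v. triple e (prod_encode (pfst x, psnd x - 1)) v \<in> S \<and>
         triple (psnd ((e - 5) div 4)) (prod_encode (pfst x, prod_encode (psnd x - 1, v))) y \<in> S) \<or>
     5 \<le> e \<and> (e - 5) mod 4 = 3 \<and>
       triple ((e - 5) div 4) (prod_encode (x, y)) 0 \<in> S \<and>
       (\<forall>m<y. \<exists>v. v \<noteq> 0 \<and> triple ((e - 5) div 4) (prod_encode (x, m)) v \<in> S)"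

text \<open>Each claim need only be justified by one rule from other claims in \<open>S\<close>,
  independently of the oracle; for a coded finite \<open>S\<close> this is decidable.\<close>

definition closed_cert :: "nat set \<Rightarrow> bool" where
  "closed_cert S \<longleftrightarrow> (\<forall>e x y. triple e x y \<in> S \<longrightarrow> derived S e x y)"

text \<open>Positive and negative answers form two separate conditions, because for a jump as oracle
  the former are enumerable and the latter have an enumerable complement.\<close>

definition oracle_cert :: "nat set \<Rightarrow> nat set \<Rightarrow> bool" where
  "oracle_cert A S \<longleftrightarrow>
     (\<forall>x. (triple 4 x 1 \<in> S \<longrightarrow> x \<in> A) \<and> (triple 4 x 0 \<in> S \<longrightarrow> x \<notin> A))"

lemma triple_eq [simp]: "triple e x y = triple e' x' y' \<longleftrightarrow> e = e' \<and> x = x' \<and> y = y'"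
  unfolding triple_def by simp

text \<open>The offsets 5 to 8 give \<open>e - 5\<close> the residues 0 to 3 modulo 4, so the number
  of a compound program selects its own disjuncts of \<open>derived\<close>; for \<open>Prec\<close>
  the recursion variable decides between two.\<close>

lemma derived_simps:
  "derived S (prog_number Zero) x y \<longleftrightarrow> y = 0"
  "derived S (prog_number Succ) x y \<longleftrightarrow> y = Suc x"
  "derived S (prog_number Fst) x y \<longleftrightarrow> y = pfst x"
  "derived S (prog_number Snd) x y \<longleftrightarrow> y = psnd x"
  "derived S (prog_number Query) x y \<longleftrightarrow> y = 0 \<or> y = 1"
  "derived S (prog_number (Pair p q)) x y \<longleftrightarrow>
     triple (prog_number p) x (pfst y) \<in> S \<and> triple (prog_number q) x (psnd y) \<in> S"
  "derived S (prog_number (Comp p q)) x y \<longleftrightarrow>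
     (\<exists>u. triple (prog_number q) x u \<in> S \<and> triple (prog_number p) u y \<in> S)"
  "derived S (prog_number (Prec p q)) (prod_encode (a, 0)) y \<longleftrightarrow> triple (prog_number p) a y \<in> S"
  "derived S (prog_number (Prec p q)) (prod_encode (a, Suc m)) y \<longleftrightarrow>
     (\<exists>v. triple (prog_number (Prec p q)) (prod_encode (a, m)) v \<in> S \<and>
       triple (prog_number q) (prod_encode (a, prod_encode (m, v))) y \<in> S)"
  "derived S (prog_number (Mu p)) x y \<longleftrightarrow>
     triple (prog_number p) (prod_encode (x, y)) 0 \<in> S \<and>
     (\<forall>m<y. \<exists>v. v \<noteq> 0 \<and> triple (prog_number p) (prod_encode (x, m)) v \<in> S)"
proof -
  define k where "k = prod_encode (prog_number p, prog_number q)"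
  have s: "4 * k + 5 - 5 = 4 * k" "4 * k + 6 - 5 = 1 + 4 * k" "4 * k + 7 - 5 = 2 + 4 * k"
    "4 * k + 8 - 5 = 3 + 4 * k" for k :: nat
    by simp_all
  have a: "(4 * k + 5 - 5) mod 4 = 0" "(4 * k + 6 - 5) mod 4 = 1" "(4 * k + 7 - 5) mod 4 = 2"
    "(4 * k + 8 - 5) mod 4 = 3"
    "(4 * k + 5 - 5) div 4 = k" "(4 * k + 6 - 5) div 4 = k" "(4 * k + 7 - 5) div 4 = k"
    "(4 * k + 8 - 5) div 4 = k" for k :: nat
    by (simp_all only: s mod_mult_self2 div_mult_self2 mod_mult_self1_is_0) simp_all
  have b: "4 * k + 5 \<noteq> 0" "4 * k + 5 \<noteq> 1" "4 * k + 5 \<noteq> 2" "4 * k + 5 \<noteq> 3" "4 * k + 5 \<noteq> 4"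
    "4 * k + 6 \<noteq> 0" "4 * k + 6 \<noteq> 1" "4 * k + 6 \<noteq> 2" "4 * k + 6 \<noteq> 3" "4 * k + 6 \<noteq> 4"
    "4 * k + 7 \<noteq> 0" "4 * k + 7 \<noteq> 1" "4 * k + 7 \<noteq> 2" "4 * k + 7 \<noteq> 3" "4 * k + 7 \<noteq> 4"
    "4 * k + 8 \<noteq> 0" "4 * k + 8 \<noteq> 1" "4 * k + 8 \<noteq> 2" "4 * k + 8 \<noteq> 3" "4 * k + 8 \<noteq> 4"
    "5 \<le> 4 * k + 5" "5 \<le> 4 * k + 6" "5 \<le> 4 * k + 7" "5 \<le> 4 * k + 8" for k :: nat
    by simp_all
  have d: "pfst k = prog_number p" "psnd k = prog_number q" unfolding k_def by simp_all
  have n: "(0::nat) \<noteq> 1" "(0::nat) \<noteq> 2" "(0::nat) \<noteq> 3" "(1::nat) \<noteq> 2" "(1::nat) \<noteq> 3" "(2::nat) \<noteq> 3"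
    by simp_all
  show "derived S (prog_number Zero) x y \<longleftrightarrow> y = 0"
    "derived S (prog_number Succ) x y \<longleftrightarrow> y = Suc x"
    "derived S (prog_number Fst) x y \<longleftrightarrow> y = pfst x"
    "derived S (prog_number Snd) x y \<longleftrightarrow> y = psnd x"
    "derived S (prog_number Query) x y \<longleftrightarrow> y = 0 \<or> y = 1"
    unfolding derived_def by simp_all
  show "derived S (prog_number (Pair p q)) x y \<longleftrightarrow>
     triple (prog_number p) x (pfst y) \<in> S \<and> triple (prog_number q) x (psnd y) \<in> S"
    unfolding derived_def prog_number.simps k_def[symmetric]
    by (simp only: a b d n n[symmetric] simp_thms)
  show "derived S (prog_number (Comp p q)) x y \<longleftrightarrow>
     (\<exists>u. triple (prog_number q) x u \<in> S \<and> triple (prog_number p) u y \<in> S)"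
    unfolding derived_def prog_number.simps k_def[symmetric]
    by (simp only: a b d n n[symmetric] simp_thms)
  show "derived S (prog_number (Prec p q)) (prod_encode (a, 0)) y \<longleftrightarrow>
      triple (prog_number p) a y \<in> S"
    unfolding derived_def prog_number.simps k_def[symmetric]
    by (simp only: a b d n n[symmetric] simp_thms prod_encode_inverse fst_conv snd_conv)
  show "derived S (prog_number (Prec p q)) (prod_encode (a, Suc m)) y \<longleftrightarrow>
     (\<exists>v. triple (prog_number (Prec p q)) (prod_encode (a, m)) v \<in> S \<and>
       triple (prog_number q) (prod_encode (a, prod_encode (m, v))) y \<in> S)"
    unfolding derived_def prog_number.simps k_def[symmetric]
    by (simp only: a b d n n[symmetric] simp_thms prod_encode_inverse fst_conv snd_conv
        nat.distinct diff_Suc_1)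
  show "derived S (prog_number (Mu p)) x y \<longleftrightarrow>
     triple (prog_number p) (prod_encode (x, y)) 0 \<in> S \<and>
     (\<forall>m<y. \<exists>v. v \<noteq> 0 \<and> triple (prog_number p) (prod_encode (x, m)) v \<in> S)"
    unfolding derived_def prog_number.simps
    by (simp only: a b n n[symmetric] simp_thms)
qed

text \<open>
  No order on the elements of a certificate is needed: a triple only refers to triples for
  subprograms or, for \<open>Prec\<close>, to the same program with a smaller recursion variable.
\<close>

lemma certificate_sound:
  assumes "closed_cert S" "oracle_cert A S" "triple (prog_number p) x y \<in> S"
  shows "run A p x = Some y"
  using assms(3)
proof (induction p arbitrary: x y)
  case (Comp p q)
  from Comp.prems assms(1) have "derived S (prog_number (Comp p q)) x y"
    unfolding closed_cert_def by blast
  with Comp.IH show ?case unfolding derived_simps by fastforce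
next
  case (Pair p q)
  from Pair.prems assms(1) have "derived S (prog_number (Pair p q)) x y"
    unfolding closed_cert_def by blast
  then have "run A p x = Some (pfst y)" "run A q x = Some (psnd y)"
    unfolding derived_simps using Pair.IH by blast+
  then show ?case by simp
next
  case (Prec p q)
  \<comment> \<open>The recursive premise concerns the same program, so an inner induction on the
    recursion variable is required.\<close>
  have "triple (prog_number (Prec p q)) (prod_encode (a, m)) y \<in> S \<Longrightarrow>
      run A (Prec p q) (prod_encode (a, m)) = Some y" for a m y
  proof (induction m arbitrary: y)
    case 0
    with assms(1) have "derived S (prog_number (Prec p q)) (prod_encode (a, 0)) y"
      unfolding closed_cert_def by blast
    then show ?case unfolding derived_simps using Prec.IH(1) by simp
  next
    case (Suc m)
    with assms(1) have "derived S (prog_number (Prec p q)) (prod_encode (a, Suc m)) y"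
      unfolding closed_cert_def by blast
    then obtain v where v: "triple (prog_number (Prec p q)) (prod_encode (a, m)) v \<in> S"
      "triple (prog_number q) (prod_encode (a, prod_encode (m, v))) y \<in> S"
      unfolding derived_simps by blast
    from Suc.IH[OF v(1)] Prec.IH(2)[OF v(2)] show ?case by simp
  qed
  from this[of "pfst x" "psnd x"] Prec.prems show ?case by (simp del: prog_number.simps run.simps)
next
  case (Mu p)
  from Mu.prems assms(1) have "derived S (prog_number (Mu p)) x y"
    unfolding closed_cert_def by blast
  then have y: "run A p (prod_encode (x, y)) = Some 0"
    and m: "\<And>m. m < y \<Longrightarrow> \<exists>v. v \<noteq> 0 \<and> run A p (prod_encode (x, m)) = Some v"
    unfolding derived_simps using Mu.IH by blast+
  have "(LEAST n. run A p (prod_encode (x, n)) = Some 0) = y"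
  proof (rule Least_equality, rule y)
    fix n assume "run A p (prod_encode (x, n)) = Some 0"
    then show "y \<le> n" using m[of n] by (cases "n < y") auto
  qed
  moreover have "\<forall>m<y. run A p (prod_encode (x, m)) \<noteq> None"
    using m by fastforce
  ultimately show ?case using y by auto
next
  case Query
  with assms(1) have "derived S (prog_number Query) x y"
    unfolding closed_cert_def by blast
  then show ?case using Query assms(2) unfolding derived_simps oracle_cert_def by auto
qed (drule assms(1)[unfolded closed_cert_def, rule_format], simp only: derived_simps run.simps)+

text \<open>\<open>S\<close> occurs only positively in \<open>derived\<close>. Hence certificates
  can be united and enlarged.\<close>

lemma derived_mono: "derived S e x y \<Longrightarrow> S \<subseteq> S' \<Longrightarrow> derived S' e x y"
  unfolding derived_def by (elim disjE) (simp; blast)+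

definition certified :: "nat set \<Rightarrow> nat set \<Rightarrow> bool" where
  "certified A F \<longleftrightarrow> (\<exists>S. finite S \<and> closed_cert S \<and> oracle_cert A S \<and> F \<subseteq> S)"

lemma certified_Un: "certified A F \<Longrightarrow> certified A G \<Longrightarrow> certified A (F \<union> G)"
proof -
  assume "certified A F" "certified A G"
  then obtain S S' where "finite S" "closed_cert S" "oracle_cert A S" "F \<subseteq> S"
    "finite S'" "closed_cert S'" "oracle_cert A S'" "G \<subseteq> S'"
    unfolding certified_def by blast
  then have "finite (S \<union> S') \<and> closed_cert (S \<union> S') \<and> oracle_cert A (S \<union> S') \<and> F \<union> G \<subseteq> S \<union> S'"
    unfolding closed_cert_def oracle_cert_def using derived_mono[of S _ _ _ "S \<union> S'"]
      derived_mono[of S' _ _ _ "S \<union> S'"] by blast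
  then show ?thesis unfolding certified_def by blast
qed

lemma certified_empty: "certified A {}"
  unfolding certified_def closed_cert_def oracle_cert_def by blast

lemma certified_finite: "finite F \<Longrightarrow> (\<And>t. t \<in> F \<Longrightarrow> certified A {t}) \<Longrightarrow> certified A F"
  by (induction F rule: finite_induct) (use certified_Un certified_empty in fastforce)+

text \<open>A conclusion may be added to a certificate that contains its premises. The last
  hypothesis keeps the recorded oracle answers true.\<close>

lemma certified_step:
  assumes "certified A F" "derived F e x y"
    "e = 4 \<Longrightarrow> y = (if x \<in> A then 1 else 0)"
  shows "certified A {triple e x y}"
proof -
  obtain S where S: "finite S" "closed_cert S" "oracle_cert A S" "F \<subseteq> S"
    using assms(1) unfolding certified_def by blast
  let ?S = "insert (triple e x y) S"
  have "derived ?S e x y" using derived_mono[OF assms(2)] S(4) by blast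
  then have "closed_cert ?S"
    using S(2) derived_mono[OF _ subset_insertI] unfolding closed_cert_def
    by simp
  moreover have "oracle_cert A ?S"
    using S(3) assms(3) unfolding oracle_cert_def insert_iff triple_eq by (metis zero_neq_one)
  ultimately show ?thesis unfolding certified_def using S(1) by blast
qed

lemma certificate_complete:
  "run A p x = Some y \<Longrightarrow> certified A {triple (prog_number p) x y}"
proof (induction p arbitrary: x y)
  case (Comp p q)
  then obtain u where u: "run A q x = Some u" "run A p u = Some y"
    by (auto simp: bind_eq_Some_conv)
  show ?case
    by (rule certified_step[OF certified_Un[OF Comp.IH(1)[OF u(2)] Comp.IH(2)[OF u(1)]]])
      (simp only: derived_simps, blast, simp)
next
  case (Pair p q)
  then obtain u v where u: "run A p x = Some u" "run A q x = Some v" "y = prod_encode (u, v)"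
    by (auto simp: bind_eq_Some_conv)
  show ?case
    by (rule certified_step[OF certified_Un[OF Pair.IH(1)[OF u(1)] Pair.IH(2)[OF u(2)]]])
      (simp only: derived_simps, simp add: u, simp)
next
  case (Prec p q)
  have "run A (Prec p q) (prod_encode (a, m)) = Some y \<Longrightarrow>
      certified A {triple (prog_number (Prec p q)) (prod_encode (a, m)) y}" for a m y
  proof (induction m arbitrary: y)
    case 0
    then have "run A p a = Some y" by simp
    from Prec.IH(1)[OF this] show ?case
      by (rule certified_step) (simp only: derived_simps, blast, simp)
  next
    case (Suc m)
    then obtain v where v: "run A (Prec p q) (prod_encode (a, m)) = Some v"
      "run A q (prod_encode (a, prod_encode (m, v))) = Some y"
      by (auto simp: bind_eq_Some_conv)
    show ?case
      by (rule certified_step[OF certified_Un[OF Suc.IH[OF v(1)] Prec.IH(2)[OF v(2)]]])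
        (simp only: derived_simps, blast, simp)
  qed
  from this[of "pfst x" "psnd x"] Prec.prems show ?case by (simp del: prog_number.simps run.simps)
next
  case (Mu p)
  let ?P = "\<lambda>n. run A p (prod_encode (x, n)) = Some 0"
  from Mu.prems obtain n where n: "?P n" "\<forall>m<n. run A p (prod_encode (x, m)) \<noteq> None"
    and y: "y = (LEAST n. ?P n)" by (auto split: if_splits)
  have "?P y" unfolding y using n(1) by (rule LeastI)
  \<comment> \<open>Below the least zero \<open>y \<le> n\<close> the values are defined, and
    minimality excludes the value 0.\<close>
  have "\<exists>v. v \<noteq> 0 \<and> run A p (prod_encode (x, m)) = Some v" if "m < y" for m
  proof -
    have "m < n" using that Least_le[of ?P, OF n(1)] y by simp
    with n(2) obtain v where "run A p (prod_encode (x, m)) = Some v" by blast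
    then show ?thesis using not_less_Least[of m ?P] that y by auto
  qed
  then obtain v where v: "\<And>m. m < y \<Longrightarrow> v m \<noteq> 0"
      "\<And>m. m < y \<Longrightarrow> run A p (prod_encode (x, m)) = Some (v m)" by metis
  \<comment> \<open>The premises of the rule for \<open>Mu\<close>: the zero at \<open>y\<close> and
    a nonzero value at every smaller argument.\<close>
  let ?F = "insert (triple (prog_number p) (prod_encode (x, y)) 0)
      ((\<lambda>m. triple (prog_number p) (prod_encode (x, m)) (v m)) ` {..<y})"
  have "certified A ?F"
    by (rule certified_finite) (use Mu.IH[OF \<open>?P y\<close>] Mu.IH[OF v(2)] in auto)
  then show ?case
    by (rule certified_step) (simp only: derived_simps, use v(1) in blast, simp)
qed (auto intro: certified_step[OF certified_empty] simp: derived_def split: if_splits)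

text \<open>Normal form theorem: a convergent computation has a finite certificate, coded by a
  number \<open>w\<close>, and only the check of its oracle answers involves
  \<open>A\<close>.\<close>

lemma phi_iff_certificate:
  "phi A e x = Some y \<longleftrightarrow>
     (\<exists>w. closed_cert (set_decode w) \<and> oracle_cert A (set_decode w) \<and> triple e x y \<in> set_decode w)"
proof -
  obtain p where p: "e = prog_number p" using bij_prog_number by (metis bij_pointE)
  show ?thesis
  proof
    assume "phi A e x = Some y"
    then have "run A p x = Some y" using p by simp
    from certificate_complete[OF this] obtain S where
      "finite S" "closed_cert S" "oracle_cert A S" "triple e x y \<in> S"
      unfolding certified_def p by blast
    then show "\<exists>w. closed_cert (set_decode w) \<and> oracle_cert A (set_decode w) \<and>
        triple e x y \<in> set_decode w"
      by (metis set_encode_inverse)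
  qed (use certificate_sound p in \<open>auto simp del: prog_number.simps\<close>)
qed

section \<open>Decidability of the certificate conditions\<close>

lemma set_decode_less: "t \<in> set_decode w \<Longrightarrow> t < w"
proof -
  assume "t \<in> set_decode w"
  then have "w div 2 ^ t \<noteq> 0" by (cases "w div 2 ^ t = 0") (simp_all add: set_decode_def)
  then have "2 ^ t \<le> w" by (metis div_less not_le)
  moreover have "t < 2 ^ t" by simp
  ultimately show "t < w" by linarith
qed

lemma triple_less:
  assumes "triple e x y \<in> set_decode w"
  shows "x < w" "y < w"
proof -
  have "prod_encode (x, y) \<le> triple e x y" unfolding triple_def by (rule le_prod_encode_2)
  then show "x < w" "y < w"
    using set_decode_less[OF assms] le_prod_encode_1[of x y] le_prod_encode_2[of y x] by linarith+
qed

lemma comp_in_triple: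
  "comp_in B f \<Longrightarrow> comp_in B g \<Longrightarrow> comp_in B h \<Longrightarrow> comp_in B (\<lambda>z. triple (f z) (g z) (h z))"
  unfolding triple_def by (intro comp_intros)

text \<open>The witnesses \<open>u\<close> and \<open>v\<close> are value components of triples in
  the coded set, hence smaller than its code by \<open>triple_less\<close>. All searches become
  bounded.\<close>

lemma derived_bounded:
  "derived (set_decode w) e x y \<longleftrightarrow>
     e = 0 \<and> y = 0 \<or>
     e = 1 \<and> y = Suc x \<or>
     e = 2 \<and> y = pfst x \<or>
     e = 3 \<and> y = psnd x \<or>
     e = 4 \<and> (y = 0 \<or> y = 1) \<or>
     5 \<le> e \<and> (e - 5) mod 4 = 0 \<and>
       triple (pfst ((e - 5) div 4)) x (pfst y) \<in> set_decode w \<and>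
       triple (psnd ((e - 5) div 4)) x (psnd y) \<in> set_decode w \<or>
     5 \<le> e \<and> (e - 5) mod 4 = 1 \<and>
       (\<exists>u<w. triple (psnd ((e - 5) div 4)) x u \<in> set_decode w \<and>
         triple (pfst ((e - 5) div 4)) u y \<in> set_decode w) \<or>
     5 \<le> e \<and> (e - 5) mod 4 = 2 \<and> psnd x = 0 \<and>
       triple (pfst ((e - 5) div 4)) (pfst x) y \<in> set_decode w \<or>
     5 \<le> e \<and> (e - 5) mod 4 = 2 \<and> psnd x \<noteq> 0 \<and>
       (\<exists>v<w. triple e (prod_encode (pfst x, psnd x - 1)) v \<in> set_decode w \<and>
         triple (psnd ((e - 5) div 4)) (prod_encode (pfst x, prod_encode (psnd x - 1, v))) y
           \<in> set_decode w) \<or>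
     5 \<le> e \<and> (e - 5) mod 4 = 3 \<and>
       triple ((e - 5) div 4) (prod_encode (x, y)) 0 \<in> set_decode w \<and>
       (\<forall>m<y. \<exists>v<w. v \<noteq> 0 \<and> triple ((e - 5) div 4) (prod_encode (x, m)) v \<in> set_decode w)"
proof -
  have bound: "(\<exists>u. Q u) \<longleftrightarrow> (\<exists>u<w. Q u)" if "\<And>u. Q u \<Longrightarrow> u < w" for Q
    using that by blast
  show ?thesis
    unfolding derived_def
    by (subst (1 2 3) bound) (auto dest: triple_less(2) simp only:)
qed

lemma dec_in_derived:
  assumes "comp_in B w" "comp_in B e" "comp_in B x" "comp_in B y"
  shows "dec_in B (\<lambda>z. derived (set_decode (w z)) (e z) (x z) (y z))"
  unfolding derived_bounded
  by (intro comp_intros comp_in_triple assms assms[THEN comp_in_comp])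

text \<open>Every number is a triple, so closedness is a check of all elements, which lie below the
  code.\<close>

lemma dec_in_closed_cert:
  assumes "comp_in B f"
  shows "dec_in B (\<lambda>z. closed_cert (set_decode (f z)))"
proof -
  have "closed_cert (set_decode w) \<longleftrightarrow> (\<forall>t<w. t \<in> set_decode w \<longrightarrow>
      derived (set_decode w) (pfst t) (pfst (psnd t)) (psnd (psnd t)))" for w
  proof
    assume *: "\<forall>t<w. t \<in> set_decode w \<longrightarrow>
      derived (set_decode w) (pfst t) (pfst (psnd t)) (psnd (psnd t))"
    show "closed_cert (set_decode w)"
      unfolding closed_cert_def
    proof (intro allI impI)
      fix e x y assume t: "triple e x y \<in> set_decode w"
      show "derived (set_decode w) e x y"
        using *[rule_format, OF set_decode_less[OF t] t] by (simp add: triple_def)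
    qed
  next
    assume *: "closed_cert (set_decode w)"
    have "triple (pfst t) (pfst (psnd t)) (psnd (psnd t)) = t" for t unfolding triple_def by simp
    with * show "\<forall>t<w. t \<in> set_decode w \<longrightarrow>
      derived (set_decode w) (pfst t) (pfst (psnd t)) (psnd (psnd t))"
      unfolding closed_cert_def by metis
  qed
  then have *: "closed_cert (set_decode (f z)) \<longleftrightarrow> (\<forall>t<f z. t \<in> set_decode (f z) \<longrightarrow>
      derived (set_decode (f z)) (pfst t) (pfst (psnd t)) (psnd (psnd t)))" for z
    by blast
  show ?thesis unfolding *
    by (intro comp_intros dec_in_derived assms comp_in_comp[OF assms])
qed

lemma oracle_cert_bounded:
  "oracle_cert A (set_decode w) \<longleftrightarrow>
     (\<forall>x<w. triple 4 x 1 \<in> set_decode w \<longrightarrow> x \<in> A) \<and>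
     (\<forall>x<w. triple 4 x 0 \<in> set_decode w \<longrightarrow> x \<notin> A)"
  unfolding oracle_cert_def using triple_less(1) by blast

lemma ce_in_phi:
  assumes "comp_in B e" "comp_in B x" "comp_in B y"
  shows "ce_in B (\<lambda>z. phi B (e z) (x z) = Some (y z))"
  unfolding phi_iff_certificate oracle_cert_bounded
  by (intro ce_in_ex ce_in_dec dec_in_closed_cert comp_in_triple comp_intros
      assms[THEN comp_in_comp])

lemma ce_in_jump:
  assumes "comp_in B f"
  shows "ce_in B (\<lambda>z. f z \<in> jump B)"
proof -
  have "f z \<in> jump B \<longleftrightarrow> (\<exists>y. phi B (f z) (f z) = Some y)" for z unfolding jump_def by auto
  then show ?thesis
    by (simp only:) (intro ce_in_ex ce_in_phi comp_intros assms[THEN comp_in_comp])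
qed

lemma ce_in_ce_set:
  assumes "comp_in B f" "comp_in B g"
  shows "ce_in B (\<lambda>z. f z \<in> ce_set (g z))"
proof -
  have "pfst z \<in> ce_set (psnd z) \<longleftrightarrow> (\<exists>y. phi {} (psnd z) (pfst z) = Some y)" for z
    unfolding ce_set_def by auto
  then have "ce_in {} (\<lambda>z. pfst z \<in> ce_set (psnd z))"
    by (simp only:) (intro ce_in_ex ce_in_phi comp_intros)
  from ce_in_comp2[OF ce_in_empty[OF this] assms] show ?thesis .
qed

text \<open>The core of Post's theorem. Guess a certificate for a computation with oracle
  \<open>jump B\<close>: its positive answers have witnesses, and once a bound for these is guessed
  too, they are decidable in \<open>B\<close>. What remains is negative answers, whose failure is
  enumerable in \<open>B\<close>.\<close>

lemma ce_in_jump_normal_form: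
  assumes "ce_in (jump B) P"
  obtains R where "ce_in B (\<lambda>z. R (pfst z) (psnd z))" "\<And>x. P x \<longleftrightarrow> (\<exists>v. \<not> R x v)"
proof -
  obtain D where D: "dec_in (jump B) (\<lambda>z. D (pfst z) (psnd z))" "\<And>x. P x \<longleftrightarrow> (\<exists>w. D x w)"
    using assms unfolding ce_in_def by auto
  then obtain p where p: "\<And>z. run (jump B) p z = Some (of_bool (D (pfst z) (psnd z)))"
    unfolding dec_in_def comp_in_def by auto
  have "ce_in B (\<lambda>x. x \<in> jump B)" by (intro ce_in_jump comp_intros)
  then obtain J where J: "dec_in B (\<lambda>z. J (pfst z) (psnd z))" "\<And>x. x \<in> jump B \<longleftrightarrow> (\<exists>w. J x w)"
    unfolding ce_in_def by auto
  \<comment> \<open>\<open>R x v\<close> says that \<open>v\<close> fails as evidence. Here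
    \<open>v\<close> codes the witness for \<open>D\<close>, the certificate and the bound for the
    witnesses of positive answers.\<close>
  define R where "R x v \<longleftrightarrow>
      \<not> (closed_cert (set_decode (pfst (psnd v))) \<and>
         triple (prog_number p) (prod_encode (x, pfst v)) 1 \<in> set_decode (pfst (psnd v)) \<and>
         (\<forall>i<pfst (psnd v). \<exists>w<psnd (psnd v).
           triple 4 i 1 \<in> set_decode (pfst (psnd v)) \<longrightarrow> J i w)) \<or>
      (\<exists>i<pfst (psnd v). triple 4 i 0 \<in> set_decode (pfst (psnd v)) \<and> i \<in> jump B)" for x v
  have "D x w \<longleftrightarrow> (\<exists>S W. \<not> R x (prod_encode (w, prod_encode (S, W))))" for x w
  proof -
    have "D x w \<longleftrightarrow> phi (jump B) (prog_number p) (prod_encode (x, w)) = Some 1"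
      by (simp add: p)
    also have "\<dots> \<longleftrightarrow> (\<exists>S. closed_cert (set_decode S) \<and> oracle_cert (jump B) (set_decode S) \<and>
        triple (prog_number p) (prod_encode (x, w)) 1 \<in> set_decode S)"
      unfolding phi_iff_certificate ..
    also have "\<dots> \<longleftrightarrow> (\<exists>S W. \<not> R x (prod_encode (w, prod_encode (S, W))))"
    proof -
      have "(\<forall>i<S. triple 4 i 1 \<in> set_decode S \<longrightarrow> i \<in> jump B) \<longleftrightarrow>
          (\<forall>i<S. \<exists>w. triple 4 i 1 \<in> set_decode S \<longrightarrow> J i w)" for S
        unfolding J(2) by blast
      also have "\<dots> S \<longleftrightarrow>
          (\<exists>W. \<forall>i<S. \<exists>w<W. triple 4 i 1 \<in> set_decode S \<longrightarrow> J i w)" for S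
        by (rule collect_bounded)
      finally have *: "oracle_cert (jump B) (set_decode S) \<longleftrightarrow>
          (\<exists>W. (\<forall>i<S. \<exists>w<W. triple 4 i 1 \<in> set_decode S \<longrightarrow> J i w) \<and>
            \<not> (\<exists>i<S. triple 4 i 0 \<in> set_decode S \<and> i \<in> jump B))" for S
        unfolding oracle_cert_bounded ex_simps by meson
      show ?thesis
        unfolding R_def * prod_encode_inverse fst_conv snd_conv de_Morgan_disj not_not
        by (simp only: ex_simps conj_ac)
    qed
    finally show ?thesis .
  qed
  then have "P x \<longleftrightarrow> (\<exists>v. \<not> R x v)" for x
    unfolding D(2) by (metis prod_decode_inverse surj_pair)
  moreover have "ce_in B (\<lambda>z. R (pfst z) (psnd z))"
    unfolding R_def
    by (intro ce_in_disj ce_in_ex_less ce_in_conj ce_in_jump comp_intros)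
      (intro ce_in_dec comp_intros comp_in_triple dec_in_closed_cert dec_in_comp2[OF J(1)])+
  ultimately show thesis using that by blast
qed

section \<open>Rational approximations\<close>

text \<open>Under \<open>int_decode\<close> even codes \<open>2 * a\<close> stand for
  \<open>a\<close> and odd codes for negative integers.\<close>

definition rat_num :: "nat \<Rightarrow> nat" where
  "rat_num j = (if even (pfst j) then pfst j div 2 else 0)"

text \<open>Negative approximations are cut off at 0: all reals approximated below are nonnegative.\<close>

lemma rat_num_eq: "real (rat_num j) / real (Suc (psnd j)) = max 0 (rat_enum j)"
proof (cases "even (pfst j)")
  case True
  then have "rat_enum j = real (rat_num j) / real (Suc (psnd j))"
    unfolding rat_num_def rat_enum_def int_decode_def sum_decode_def by (simp add: case_prod_beta)
  moreover have "0 \<le> real (rat_num j) / real (Suc (psnd j))" by simp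
  ultimately show ?thesis by (simp only: max_absorb2)
next
  case False
  then have "rat_enum j = (- real (pfst j div 2) - 1) / real (Suc (psnd j))"
    unfolding rat_enum_def int_decode_def sum_decode_def by (simp add: case_prod_beta)
  also have "\<dots> \<le> 0" by (simp add: divide_le_0_iff)
  finally show ?thesis using False by (simp add: rat_num_def)
qed

lemma rat_num_approx:
  "0 \<le> r \<Longrightarrow> \<bar>rat_enum j - r\<bar> \<le> e \<Longrightarrow> \<bar>real (rat_num j) / real (Suc (psnd j)) - r\<bar> \<le> e"
  unfolding rat_num_eq by (auto simp: max_def)

lemma comp_in_rat_num: "comp_in B f \<Longrightarrow> comp_in B (\<lambda>x. rat_num (f x))"
  unfolding rat_num_def by (intro comp_intros)

text \<open>Numerators are doubled to code nonnegative integers, and 1 is subtracted because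
  denominators are coded by their predecessors.\<close>

lemma rat_enum_dyadic: "rat_enum (prod_encode (2 * a, 2 ^ N - 1)) = real a / 2 ^ N"
proof -
  have "real (Suc (2 ^ N - 1)) = 2 ^ N" by simp
  then show ?thesis
    unfolding rat_enum_def int_decode_def sum_decode_def by (simp del: of_nat_Suc)
qed

lemma pos_rat_enum_eq: "pos_rat_enum j = real (Suc (pfst j)) / real (Suc (psnd j))"
  unfolding pos_rat_enum_def by (simp add: case_prod_beta)

lemma frac_less_iff:
  fixes a b c d :: real
  assumes "b > 0" "d > 0"
  shows "a / b < c / d \<longleftrightarrow> a * d < c * b"
  using assms by (simp add: field_simps)

text \<open>Clearing denominators yields a comparison of natural numbers, which
  \<open>dec_in_less\<close> handles.\<close>

lemma sum_fractions_less_iff: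
  assumes "D > 0" "E > 0" "b > 0" "c > 0"
  shows "real N / real D + 1 / real E + real B / real b < real C / real c \<longleftrightarrow>
    (N * E * b + D * b + B * D * E) * c < C * (D * E * b)"
proof -
  have "real N / real D + 1 / real E + real B / real b =
      real (N * E * b + D * b + B * D * E) / real (D * E * b)"
    using assms by (simp add: field_simps)
  then show ?thesis
    using frac_less_iff[of "real (D * E * b)" "real c" "real (N * E * b + D * b + B * D * E)"
        "real C"] assms
    by (simp only: of_nat_0_less_iff mult_pos_pos of_nat_mult[symmetric] of_nat_less_iff simp_thms)
qed

lemma power_half_less: "0 < e \<Longrightarrow> \<exists>m. (1/2) ^ m < (e :: real)"
  by (rule real_arch_pow_inv) auto

section \<open>Ideal balls\<close>

lemma ideal_ball_eq: "ideal_ball s k = {x. dist x (s (pfst k)) < pos_rat_enum (psnd k)}"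
  unfolding ideal_ball_def by (simp add: case_prod_beta)

lemma open_ideal_ball: "open (ideal_ball s k)"
  unfolding ideal_ball_eq by (intro open_Collect_less continuous_intros)

text \<open>Formal inclusion of balls: it implies inclusion by the triangle inequality and, being a
  strict inequality between computable reals, is enumerable.\<close>

definition ball_below :: "(nat \<Rightarrow> 'a::polish_space) \<Rightarrow> nat \<Rightarrow> nat \<Rightarrow> bool" where
  "ball_below s k i \<longleftrightarrow>
     dist (s (pfst k)) (s (pfst i)) + pos_rat_enum (psnd k) < pos_rat_enum (psnd i)"

lemma ball_below_subset:
  assumes "ball_below s k i"
  shows "ideal_ball s k \<subseteq> ideal_ball s i"
proof
  fix x assume "x \<in> ideal_ball s k"
  then show "x \<in> ideal_ball s i"
    using assms dist_triangle[of x "s (pfst i)" "s (pfst k)"]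
    unfolding ideal_ball_eq ball_below_def by simp
qed

lemma ideal_ball_Int:
  assumes "closure (range s) = UNIV"
  shows "ideal_ball s i \<inter> ideal_ball s j = (\<Union>k\<in>{k. ball_below s k i \<and> ball_below s k j}. ideal_ball s k)"
proof
  show "ideal_ball s i \<inter> ideal_ball s j
      \<subseteq> (\<Union>k\<in>{k. ball_below s k i \<and> ball_below s k j}. ideal_ball s k)"
  proof
    fix x assume x: "x \<in> ideal_ball s i \<inter> ideal_ball s j"
    \<comment> \<open>The smaller slack of \<open>x\<close> in the two balls. A radius below
      \<open>e / 2\<close> suffices, since it is spent twice: on the distance from \<open>x\<close>
      to the new centre and on the new radius.\<close>
    define e where "e = min (pos_rat_enum (psnd i) - dist x (s (pfst i)))
      (pos_rat_enum (psnd j) - dist x (s (pfst j)))"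
    have "e / 2 > 0" using x unfolding e_def ideal_ball_eq by simp
    then obtain n where n: "inverse (real (Suc n)) < e / 2" using reals_Archimedean by blast
    let ?q = "inverse (real (Suc n))"
    have "x \<in> closure (range s)" using assms by simp
    then obtain a where a: "dist (s a) x < ?q"
      unfolding closure_approachable by (metis (no_types, lifting) imageE inverse_positive_iff_positive of_nat_0_less_iff zero_less_Suc)
    \<comment> \<open>The pair \<open>(0, n)\<close> codes the radius
      \<open>1 / (n + 1)\<close>.\<close>
    define k where "k = prod_encode (a, prod_encode (0, n))"
    have q: "pos_rat_enum (psnd k) = ?q" "pfst k = a"
      unfolding k_def pos_rat_enum_eq by (simp_all add: inverse_eq_divide)
    have below: "ball_below s k l" if "e \<le> pos_rat_enum (psnd l) - dist x (s (pfst l))" for l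
      using dist_triangle[of "s a" "s (pfst l)" x] a n that
      unfolding ball_below_def q by linarith
    have "x \<in> ideal_ball s k" unfolding ideal_ball_eq q using a by (simp add: dist_commute)
    moreover have "ball_below s k i" "ball_below s k j"
      by (rule below, simp add: e_def)+
    ultimately show "x \<in> (\<Union>k\<in>{k. ball_below s k i \<and> ball_below s k j}. ideal_ball s k)" by blast
  qed
qed (use ball_below_subset in blast)

lemma Union_ideal_ball: "(\<Union>k. ideal_ball s k) = UNIV"
proof -
  have "\<exists>k. x \<in> ideal_ball s k" for x
  proof -
    obtain n where "dist x (s 0) < real n" using reals_Archimedean2 by blast
    then show ?thesis
      by (intro exI[of _ "prod_encode (0, prod_encode (n, 0))"])
        (simp add: ideal_ball_eq pos_rat_enum_eq)
  qed
  then show ?thesis by blast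
qed

text \<open>The inequality holds iff some approximation of the distance still satisfies it after its
  error bound is added; the formula in \<open>eq\<close> states this without denominators.\<close>

lemma ce_in_ball_below:
  assumes "computable_metric_space s" "comp_in B k" "comp_in B i"
  shows "ce_in B (\<lambda>z. ball_below s (k z) (i z))"
proof -
  obtain f where f: "comp_in {} f"
    "\<And>k. computable_real_index {} (dist (s (pfst k)) (s (psnd k))) (f k)"
    using assms(1) unfolding computable_metric_space_def uniformly_def computable_iff
    by (auto simp: case_prod_beta)
  have eq: "ball_below s k i \<longleftrightarrow> (\<exists>m j. phi {} (f (prod_encode (pfst k, pfst i))) m = Some j \<and>
      (rat_num j * 2 ^ m * Suc (psnd (psnd k)) + Suc (psnd j) * Suc (psnd (psnd k)) +
        Suc (pfst (psnd k)) * Suc (psnd j) * 2 ^ m) * Suc (psnd (psnd i)) <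
      Suc (pfst (psnd i)) * (Suc (psnd j) * 2 ^ m * Suc (psnd (psnd k))))" (is "_ \<longleftrightarrow> ?R") for k i
  proof -
    let ?d = "dist (s (pfst k)) (s (pfst i))"
    let ?q = "pos_rat_enum (psnd k)" and ?q' = "pos_rat_enum (psnd i)"
    let ?p = "phi {} (f (prod_encode (pfst k, pfst i)))"
    have appr: "\<exists>j. ?p m = Some j \<and> \<bar>real (rat_num j) / real (Suc (psnd j)) - ?d\<bar> \<le> (1/2) ^ m" for m
    proof -
      have "\<exists>j. ?p m = Some j \<and> \<bar>rat_enum j - ?d\<bar> \<le> (1/2) ^ m"
        using f(2)[of "prod_encode (pfst k, pfst i)"] unfolding computable_real_index_def by simp
      then show ?thesis using rat_num_approx[of ?d _ "(1/2) ^ m"] by auto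
    qed
    have "ball_below s k i \<longleftrightarrow>
        (\<exists>m j. ?p m = Some j \<and> real (rat_num j) / real (Suc (psnd j)) + 1 / real (2 ^ m) + ?q < ?q')"
    proof
      assume "ball_below s k i"
      \<comment> \<open>Half of the gap, because the error bound counts twice: once in the
        approximation and once as the summand added to it.\<close>
      then have "(?q' - (?d + ?q)) / 2 > 0" unfolding ball_below_def by simp
      then obtain m where m: "(1/2) ^ m < (?q' - (?d + ?q)) / 2" using power_half_less by blast
      obtain j where j: "?p m = Some j" "\<bar>real (rat_num j) / real (Suc (psnd j)) - ?d\<bar> \<le> (1/2) ^ m"
        using appr by blast
      have e: "1 / real (2 ^ m) = (1/2) ^ m" by (simp add: power_one_over)
      have "r + p + q < q'" if "\<bar>r - d\<bar> \<le> p" "p < (q' - (d + q)) / 2" for r d p q q' :: real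
        using that by (simp add: field_simps)
      from this[OF j(2) m] have "real (rat_num j) / real (Suc (psnd j)) + 1 / real (2 ^ m) + ?q < ?q'"
        unfolding e .
      with j(1) show "\<exists>m j. ?p m = Some j \<and>
          real (rat_num j) / real (Suc (psnd j)) + 1 / real (2 ^ m) + ?q < ?q'" by blast
    next
      assume "\<exists>m j. ?p m = Some j \<and>
          real (rat_num j) / real (Suc (psnd j)) + 1 / real (2 ^ m) + ?q < ?q'"
      then obtain m j where j: "?p m = Some j"
        "real (rat_num j) / real (Suc (psnd j)) + 1 / real (2 ^ m) + ?q < ?q'" by blast
      have "\<bar>real (rat_num j) / real (Suc (psnd j)) - ?d\<bar> \<le> (1/2) ^ m"
        using appr[of m] j(1) by auto
      moreover have e: "1 / real (2 ^ m) = (1/2) ^ m" by (simp add: power_one_over)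
      have "d + q < q'" if "\<bar>r - d\<bar> \<le> p" "r + p + q < q'" for r d p q q' :: real
        using that by simp
      ultimately have "?d + ?q < ?q'" using j(2) unfolding e by blast
      then show "ball_below s k i" unfolding ball_below_def .
    qed
    also have "\<dots> \<longleftrightarrow> ?R"
      unfolding pos_rat_enum_eq by (subst sum_fractions_less_iff) simp_all
    finally show ?thesis .
  qed
  have "ce_in {} (\<lambda>z. ball_below s (pfst z) (psnd z))"
    unfolding eq
    by (intro ce_in_ex ce_in_conj ce_in_phi comp_intros comp_in_comp[OF f(1)])
      (intro ce_in_dec comp_intros comp_in_rat_num)
  from ce_in_comp2[OF ce_in_empty[OF this] assms(2,3)] show ?thesis .
qed

section \<open>Uniform closure properties of the Borel hierarchy\<close>

lemma borel_Sigma_set: "Sigma_set s n e \<in> sets borel"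
proof (induction s n e rule: Sigma_set.induct)
  case (2 s e)
  have "open (\<Union>i\<in>ce_set e. ideal_ball s i)" by (intro open_UN ballI open_ideal_ball)
  then show ?case by simp
next
  case (3 s n e)
  then show ?case by (auto intro!: sets.countable_UN' simp del: Sigma_set.simps(2))
qed simp

text \<open>At every level a set is a union of pieces over an enumerable set, and the enumerations
  for all \<open>e\<close> with \<open>P k e\<close> can be merged.\<close>

lemma Sigma_set_Union_ce:
  assumes "ce_in {} (\<lambda>z. P (pfst z) (psnd z))"
  obtains h where "comp_in {} h"
    "\<And>k. Sigma_set s (Suc n) (h k) = (\<Union>e\<in>{e. P k e}. Sigma_set s (Suc n) e)"
proof -
  have "ce_in {} (\<lambda>z. \<exists>e. P (pfst z) e \<and> psnd z \<in> ce_set e)"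
    by (intro ce_in_ex ce_in_conj ce_in_comp2[OF assms] ce_in_ce_set comp_intros)
  from ce_set_index[of "\<lambda>k i. \<exists>e. P k e \<and> i \<in> ce_set e", OF this]
  obtain h where h: "comp_in {} h" "\<And>k. ce_set (h k) = {i. \<exists>e. P k e \<and> i \<in> ce_set e}" by blast
  have "Sigma_set s (Suc n) (h k) = (\<Union>e\<in>{e. P k e}. Sigma_set s (Suc n) e)" for k
    by (cases n) (auto simp: h(2))
  with h(1) show thesis using that by blast
qed

lemma Sigma_set_Un:
  obtains u where "comp_in {} u"
    "\<And>a b. Sigma_set s (Suc n) (u (prod_encode (a, b))) =
      Sigma_set s (Suc n) a \<union> Sigma_set s (Suc n) b"
proof -
  have "ce_in {} (\<lambda>z. psnd z = pfst (pfst z) \<or> psnd z = psnd (pfst z))"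
    by (intro ce_in_dec comp_intros)
  from Sigma_set_Union_ce[of "\<lambda>k e. e = pfst k \<or> e = psnd k" s n, OF this]
  obtain h where h: "comp_in {} h" "\<And>k. Sigma_set s (Suc n) (h k) =
      (\<Union>e\<in>{e. e = pfst k \<or> e = psnd k}. Sigma_set s (Suc n) e)" by blast
  have "Sigma_set s (Suc n) (h (prod_encode (a, b))) =
      Sigma_set s (Suc n) a \<union> Sigma_set s (Suc n) b" for a b
    unfolding h(2) by auto
  with h(1) show thesis using that by blast
qed

text \<open>At the lowest level, balls are intersected through formal inclusions. Above it, an
  intersection of two complements is the complement of a union, whose index
  \<open>Sigma_set_Un\<close> provides.\<close>

lemma Sigma_set_Int:
  assumes "computable_metric_space s"
  obtains g where "comp_in {} g"
    "\<And>a b. Sigma_set s (Suc n) (g (prod_encode (a, b))) =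
      Sigma_set s (Suc n) a \<inter> Sigma_set s (Suc n) b"
proof (cases n)
  case 0
  have "ce_in {} (\<lambda>z. \<exists>i j. i \<in> ce_set (pfst (pfst z)) \<and> j \<in> ce_set (psnd (pfst z)) \<and>
      ball_below s (psnd z) i \<and> ball_below s (psnd z) j)"
    by (intro ce_in_ex ce_in_conj ce_in_ce_set ce_in_ball_below[OF assms] comp_intros)
  from ce_set_index[of "\<lambda>z k. \<exists>i j. i \<in> ce_set (pfst z) \<and> j \<in> ce_set (psnd z) \<and>
      ball_below s k i \<and> ball_below s k j", OF this]
  obtain h where h: "comp_in {} h" "\<And>z. ce_set (h z) =
      {k. \<exists>i j. i \<in> ce_set (pfst z) \<and> j \<in> ce_set (psnd z) \<and> ball_below s k i \<and> ball_below s k j}"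
    by blast
  have dense: "closure (range s) = UNIV" using assms unfolding computable_metric_space_def by blast
  have "(\<Union>i\<in>ce_set a. ideal_ball s i) \<inter> (\<Union>j\<in>ce_set b. ideal_ball s j) =
      (\<Union>i\<in>ce_set a. \<Union>j\<in>ce_set b. ideal_ball s i \<inter> ideal_ball s j)" for a b by blast
  also have "\<dots> a b = (\<Union>k\<in>ce_set (h (prod_encode (a, b))). ideal_ball s k)" for a b
    unfolding ideal_ball_Int[OF dense] h(2) by auto
  finally have "Sigma_set s (Suc n) (h (prod_encode (a, b))) =
      Sigma_set s (Suc n) a \<inter> Sigma_set s (Suc n) b" for a b
    using 0 by simp
  with h(1) show thesis using that by blast
next
  case (Suc m)
  obtain u where u: "comp_in {} u"
    "\<And>a b. Sigma_set s (Suc m) (u (prod_encode (a, b))) =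
      Sigma_set s (Suc m) a \<union> Sigma_set s (Suc m) b" using Sigma_set_Un[of s m] by blast
  have "ce_in {} (\<lambda>z. \<exists>i j. i \<in> ce_set (pfst (pfst z)) \<and> j \<in> ce_set (psnd (pfst z)) \<and>
      psnd z = u (prod_encode (i, j)))"
    by (intro ce_in_ex ce_in_conj ce_in_ce_set comp_intros)
      (intro ce_in_dec comp_intros comp_in_comp[OF u(1)])
  from ce_set_index[of "\<lambda>z k. \<exists>i j. i \<in> ce_set (pfst z) \<and> j \<in> ce_set (psnd z) \<and>
      k = u (prod_encode (i, j))", OF this]
  obtain h where h: "comp_in {} h" "\<And>z. ce_set (h z) =
      {k. \<exists>i j. i \<in> ce_set (pfst z) \<and> j \<in> ce_set (psnd z) \<and> k = u (prod_encode (i, j))}"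
    by blast
  have "Sigma_set s (Suc n) (h (prod_encode (a, b))) =
      (\<Union>i\<in>ce_set a. \<Union>j\<in>ce_set b. - Sigma_set s (Suc m) (u (prod_encode (i, j))))" for a b
    unfolding Suc Sigma_set.simps h(2) prod_encode_inverse fst_conv snd_conv by blast
  also have "\<dots> a b = (\<Union>i\<in>ce_set a. - Sigma_set s (Suc m) i) \<inter>
      (\<Union>j\<in>ce_set b. - Sigma_set s (Suc m) j)" for a b
    unfolding u(2) by blast
  finally have "Sigma_set s (Suc n) (h (prod_encode (a, b))) =
      Sigma_set s (Suc n) a \<inter> Sigma_set s (Suc n) b" for a b
    unfolding Suc Sigma_set.simps by blast
  with h(1) show thesis using that by blast
qed

text \<open>The base case is computability of \<open>T\<close>; preimages commute with unions and
  with complements relative to \<open>D\<close>. Only traces on \<open>D\<close> are compared, since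
  the hypothesis controls nothing outside \<open>D\<close>.\<close>

lemma Sigma_set_vimage:
  assumes "computable_map_on s D T"
  obtains t where "comp_in {} t"
    "\<And>e. D \<inter> Sigma_set s (Suc n) (t e) = D \<inter> T -` Sigma_set s (Suc n) e"
proof (induction n arbitrary: thesis)
  case 0
  obtain f where f: "comp_in {} f" "\<And>i. T -` ideal_ball s i \<inter> D = D \<inter> Sigma_set s 1 (f i)"
    using assms unfolding computable_map_on_def uniformly_def computable_iff by blast
  have "ce_in {} (\<lambda>z. \<exists>i. i \<in> ce_set (pfst z) \<and> psnd z = f i)"
    by (intro ce_in_ex ce_in_conj ce_in_ce_set comp_intros)
      (intro ce_in_dec comp_intros comp_in_comp[OF f(1)])
  from Sigma_set_Union_ce[of "\<lambda>e k. \<exists>i. i \<in> ce_set e \<and> k = f i" s 0, OF this]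
  obtain t where t: "comp_in {} t" "\<And>e. Sigma_set s (Suc 0) (t e) =
      (\<Union>k\<in>{k. \<exists>i. i \<in> ce_set e \<and> k = f i}. Sigma_set s (Suc 0) k)" by blast
  have "Sigma_set s (Suc 0) (t e) = (\<Union>i\<in>ce_set e. Sigma_set s 1 (f i))" for e
    unfolding t(2) by auto
  then have "D \<inter> Sigma_set s (Suc 0) (t e) = (\<Union>i\<in>ce_set e. D \<inter> Sigma_set s 1 (f i))" for e
    by blast
  also have "\<dots> e = D \<inter> T -` Sigma_set s (Suc 0) e" for e
    unfolding f(2)[symmetric] Sigma_set.simps by blast
  finally show ?case using t(1) 0 by blast
next
  case (Suc n)
  obtain t where t: "comp_in {} t"
    "\<And>e. D \<inter> Sigma_set s (Suc n) (t e) = D \<inter> T -` Sigma_set s (Suc n) e" using Suc.IH by blast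
  have "ce_in {} (\<lambda>z. \<exists>i. i \<in> ce_set (pfst z) \<and> psnd z = t i)"
    by (intro ce_in_ex ce_in_conj ce_in_ce_set comp_intros)
      (intro ce_in_dec comp_intros comp_in_comp[OF t(1)])
  from ce_set_index[of "\<lambda>e k. \<exists>i. i \<in> ce_set e \<and> k = t i", OF this]
  obtain h where h: "comp_in {} h" "\<And>e. ce_set (h e) = {k. \<exists>i. i \<in> ce_set e \<and> k = t i}" by blast
  have "D \<inter> Sigma_set s (Suc (Suc n)) (h e) = (\<Union>i\<in>ce_set e. D - D \<inter> Sigma_set s (Suc n) (t i))" for e
    unfolding Sigma_set.simps h(2) by auto
  also have "\<dots> e = D \<inter> T -` Sigma_set s (Suc (Suc n)) e" for e
    unfolding t(2) Sigma_set.simps by auto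
  finally show ?case using h(1) Suc.prems by blast
qed

lemma ce_set_const:
  obtains e where "ce_set e = {i. c}"
proof -
  have "ce_in {} (\<lambda>z. c)" by (intro ce_in_dec comp_intros)
  then obtain h where "comp_in {} h" "\<And>k. ce_set (h k) = {i. c}"
    by (rule ce_set_index[of "\<lambda>_ _. c"]) (rule that)
  then show thesis using that[of "h 0"] by simp
qed

lemma Sigma_set_UNIV:
  obtains e where "Sigma_set s (Suc n) e = UNIV"
proof (cases n)
  case 0
  obtain e where "ce_set e = {i. True}" by (rule ce_set_const)
  then have "Sigma_set s (Suc n) e = UNIV" using 0 Union_ideal_ball[of s] by simp
  then show thesis by (rule that)
next
  case (Suc m)
  obtain a where a: "ce_set a = {i. False}" by (rule ce_set_const)
  have a: "Sigma_set s (Suc m) a = {}" by (cases m) (simp_all add: a)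
  have "ce_in {} (\<lambda>z. psnd z = a)" by (intro ce_in_dec comp_intros)
  then obtain h where "comp_in {} h" and h: "\<And>k. ce_set (h k) = {i. i = a}"
    by (rule ce_set_index[of "\<lambda>_ i. i = a"]) (rule that)
  have "Sigma_set s (Suc n) (h 0) = UNIV" using Suc a h by simp
  then show thesis by (rule that)
qed

text \<open>Post's theorem for the trivial sets: by \<open>ce_in_jump_normal_form\<close> each jump
  costs one quantifier over a negated predicate, exactly as each level adds a union of complements.
  Information from the oracle thereby enters sets with computable indices.\<close>

lemma Sigma_set_indicator:
  assumes "ce_in (zero_jump n) P"
  obtains h where "comp_in {} h" "\<And>k. Sigma_set s (Suc n) (h k) = (if P k then UNIV else {})"
  using assms
proof (induction n arbitrary: P thesis)
  case 0
  then have P: "ce_in {} P" unfolding zero_jump_def by simp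
  have "ce_in {} (\<lambda>z. P (pfst z))" by (intro ce_in_comp[OF P] comp_intros)
  from ce_set_index[of "\<lambda>k i. P k", OF this]
  obtain h where h: "comp_in {} h" "\<And>k. ce_set (h k) = {i. P k}" by blast
  then have "Sigma_set s (Suc 0) (h k) = (if P k then UNIV else {})" for k
    using Union_ideal_ball[of s] by simp
  with h(1) show ?case using 0 by blast
next
  case (Suc n)
  have "ce_in (jump (zero_jump n)) P" using Suc.prems(2) unfolding zero_jump_def by simp
  then obtain R where R: "ce_in (zero_jump n) (\<lambda>z. R (pfst z) (psnd z))"
    "\<And>x. P x \<longleftrightarrow> (\<exists>v. \<not> R x v)" by (rule ce_in_jump_normal_form) blast
  obtain g where g: "comp_in {} g"
    "\<And>z. Sigma_set s (Suc n) (g z) = (if R (pfst z) (psnd z) then UNIV else {})"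
    using Suc.IH[OF _ R(1)] by blast
  have "ce_in {} (\<lambda>z. \<exists>v. psnd z = g (prod_encode (pfst z, v)))"
    by (intro ce_in_ex ce_in_dec comp_intros comp_in_comp[OF g(1)])
  from ce_set_index[of "\<lambda>k i. \<exists>v. i = g (prod_encode (k, v))", OF this]
  obtain h where h: "comp_in {} h" "\<And>k. ce_set (h k) = {i. \<exists>v. i = g (prod_encode (k, v))}" by blast
  have "Sigma_set s (Suc (Suc n)) (h k) = (\<Union>v. - Sigma_set s (Suc n) (g (prod_encode (k, v))))" for k
    unfolding Sigma_set.simps h(2) by blast
  also have "\<dots> k = (if P k then UNIV else {})" for k
    unfolding g(2) R(2) by auto
  finally show ?case using h(1) Suc.prems(1) by blast
qed

lemma Sigma_set_finite_Int:
  assumes "computable_metric_space s"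
  obtains v where "comp_in {} v"
    "\<And>F. Sigma_set s (Suc n) (v F) = (\<Inter>i\<in>set_decode F. Sigma_set s (Suc n) i)"
proof -
  obtain g where g: "comp_in {} g"
    "\<And>a b. Sigma_set s (Suc n) (g (prod_encode (a, b))) =
      Sigma_set s (Suc n) a \<inter> Sigma_set s (Suc n) b"
    using Sigma_set_Int[OF assms] by blast
  obtain e where e: "Sigma_set s (Suc n) e = UNIV" by (rule Sigma_set_UNIV)
  \<comment> \<open>\<open>w F b\<close> intersects the members of the coded set below
    \<open>b\<close>, starting from the whole space. Taking \<open>b = F\<close> reaches all
    members, as they lie below the code.\<close>
  define w where
    "w F = rec_nat e (\<lambda>i r. if i \<in> set_decode F then g (prod_encode (r, i)) else r)" for F
  have "comp_in {} (\<lambda>F. w F F)"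
    unfolding w_def by (intro comp_in_rec comp_intros comp_in_comp[OF g(1)])
  moreover have *: "Sigma_set s (Suc n) (w F b) =
      (\<Inter>i\<in>set_decode F \<inter> {..<b}. Sigma_set s (Suc n) i)" for F b
  proof (induction b)
    case 0
    then show ?case by (simp add: w_def e)
  next
    case (Suc b)
    have "w F (Suc b) = (if b \<in> set_decode F then g (prod_encode (w F b, b)) else w F b)"
      by (simp add: w_def)
    then show ?case using Suc by (auto simp: g(2) lessThan_Suc)
  qed
  moreover have "set_decode F \<inter> {..<F} = set_decode F" for F using set_decode_less by auto
  ultimately show thesis using that[of "\<lambda>F. w F F"] by simp
qed

section \<open>Lower semicomputability of measures\<close>

text \<open>Continuity from below: a union whose measure exceeds \<open>q\<close> has a finite
  subunion that already does so.\<close>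

lemma measure_UN_greater_iff:
  fixes A :: "nat \<Rightarrow> 'a set"
  assumes "finite_measure M" "\<And>i. A i \<in> sets M"
  shows "q < measure M (\<Union>i\<in>W. A i) \<longleftrightarrow>
    (\<exists>k. set_decode k \<subseteq> W \<and> q < measure M (\<Union>i\<in>set_decode k. A i))"
proof
  interpret finite_measure M by fact
  assume q: "q < measure M (\<Union>i\<in>W. A i)"
  let ?B = "\<lambda>n. \<Union>i\<in>W \<inter> {..<n}. A i"
  have "(\<lambda>n. measure M (?B n)) \<longlonglongrightarrow> measure M (\<Union>n. ?B n)"
    by (rule finite_Lim_measure_incseq) (auto simp: incseq_def assms(2) intro!: sets.countable_UN')
  moreover have "(\<Union>n. ?B n) = (\<Union>i\<in>W. A i)" by auto
  ultimately have "\<forall>\<^sub>F n in sequentially. q < measure M (?B n)"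
    using q by (simp add: order_tendsto_iff)
  then obtain n where n: "q < measure M (?B n)" unfolding eventually_sequentially by blast
  moreover have "set_decode (set_encode (W \<inter> {..<n})) = W \<inter> {..<n}" by simp
  ultimately show "\<exists>k. set_decode k \<subseteq> W \<and> q < measure M (\<Union>i\<in>set_decode k. A i)"
    by (metis inf_le1)
next
  interpret finite_measure M by fact
  assume "\<exists>k. set_decode k \<subseteq> W \<and> q < measure M (\<Union>i\<in>set_decode k. A i)"
  then obtain k where k: "set_decode k \<subseteq> W" "q < measure M (\<Union>i\<in>set_decode k. A i)" by blast
  have "measure M (\<Union>i\<in>set_decode k. A i) \<le> measure M (\<Union>i\<in>W. A i)"
    using k(1) by (intro finite_measure_mono UN_mono) (auto simp: assms(2) intro!: sets.countable_UN')
  with k(2) show "q < measure M (\<Union>i\<in>W. A i)" by linarith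
qed

text \<open>Lower bounds of \<open>1 - r\<close> come from dyadic upper bounds of \<open>r\<close>,
  expressed as failures of \<open>b / 2 ^ K < r\<close>. If these comparisons are enumerable, the
  jump decides their failure.\<close>

lemma dyadic_gap_iff:
  assumes "0 \<le> r"
  shows "real a / 2 ^ N < 1 - r \<longleftrightarrow>
    (\<exists>b K. \<not> real b / 2 ^ K < r \<and> b * 2 ^ N + a * 2 ^ K < 2 ^ (N + K))"
proof -
  have iff: "b * 2 ^ N + a * 2 ^ K < 2 ^ (N + K) \<longleftrightarrow> real b / 2 ^ K + real a / 2 ^ N < 1" for b K
  proof -
    have "b * 2 ^ N + a * 2 ^ K < 2 ^ (N + K) \<longleftrightarrow>
        real (b * 2 ^ N + a * 2 ^ K) < real (2 ^ (N + K))" by (rule of_nat_less_iff[symmetric])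
    also have "\<dots> \<longleftrightarrow> real b / 2 ^ K + real a / 2 ^ N < 1"
      by (simp add: field_simps power_add)
    finally show ?thesis .
  qed
  show ?thesis unfolding iff
  proof
    assume "real a / 2 ^ N < 1 - r"
    then have "1 - r - real a / 2 ^ N > 0" by simp
    then obtain K where K: "(1/2) ^ K < 1 - r - real a / 2 ^ N" using power_half_less by blast
    \<comment> \<open>Rounding \<open>r\<close> up to a multiple of \<open>1 / 2 ^ K\<close> adds
      less than \<open>(1/2) ^ K\<close>, which stays within the gap.\<close>
    define b where "b = nat \<lceil>r * 2 ^ K\<rceil>"
    have b: "r * 2 ^ K \<le> real b" "real b < r * 2 ^ K + 1"
      unfolding b_def using assms by (auto simp: of_nat_nat ceiling_less_iff) linarith+
    have "r \<le> real b / 2 ^ K" using b(1) by (simp add: field_simps)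
    moreover have "real b / 2 ^ K < r + (1/2) ^ K"
      using b(2) by (simp add: field_simps power_one_over)
    ultimately show "\<exists>b K. \<not> real b / 2 ^ K < r \<and> real b / 2 ^ K + real a / 2 ^ N < 1"
      using K by (intro exI[of _ b] exI[of _ K]) linarith
  next
    assume "\<exists>b K. \<not> real b / 2 ^ K < r \<and> real b / 2 ^ K + real a / 2 ^ N < 1"
    then show "real a / 2 ^ N < 1 - r" by (elim exE conjE) linarith
  qed
qed

lemma zero_jump_Suc: "zero_jump (Suc n) = jump (zero_jump n)"
  unfolding zero_jump_def by simp

text \<open>At the first level the space provides lower bounds for finite unions of balls. At the
  next level, a finite union of complements is the complement of a finite intersection one level
  lower; its lower bounds are enumerable in the old oracle and so decidable in the new one.\<close>

lemma ce_in_measure_Sigma_set: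
  assumes "computable_probability_space s M"
    and "comp_in (zero_jump n) a" "comp_in (zero_jump n) N" "comp_in (zero_jump n) e"
  shows "ce_in (zero_jump n)
    (\<lambda>z. real (a z) / 2 ^ N z < measure M (Sigma_set s (Suc n) (e z)))"
  using assms(2-4)
proof (induction n arbitrary: a N e)
  case 0
  have M: "prob_space M" "sets M = sets borel"
    using assms(1) unfolding computable_probability_space_def by auto
  then interpret prob_space M by blast
  have meas: "ideal_ball s i \<in> sets M" for i
    unfolding M(2) by (simp add: open_ideal_ball)
  obtain f where f: "comp_in {} f"
    "\<And>k. lower_semicomputable_index (measure M (\<Union>i\<in>set_decode k. ideal_ball s i)) (f k)"
    using assms(1) unfolding computable_probability_space_def uniformly_def computable_iff by auto
  have eq: "real a / 2 ^ N < measure M (Sigma_set s (Suc 0) e) \<longleftrightarrow>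
    (\<exists>k. (\<forall>i<k. i \<in> set_decode k \<longrightarrow> i \<in> ce_set e) \<and>
      prod_encode (2 * a, 2 ^ N - 1) \<in> ce_set (f k))" for a N e
  proof -
    have "prod_encode (2 * a, 2 ^ N - 1) \<in> ce_set (f k) \<longleftrightarrow>
        real a / 2 ^ N < measure M (\<Union>i\<in>set_decode k. ideal_ball s i)" for k
      using f(2)[of k] unfolding lower_semicomputable_index_def
      by (simp only: rat_enum_dyadic mem_Collect_eq)
    moreover have "(\<forall>i<k. i \<in> set_decode k \<longrightarrow> i \<in> ce_set e) \<longleftrightarrow> set_decode k \<subseteq> ce_set e" for k
      using set_decode_less by blast
    ultimately show ?thesis
      using measure_UN_greater_iff[OF finite_measure_axioms, of "ideal_ball s" "real a / 2 ^ N" "ce_set e", OF meas]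
      by simp
  qed
  show ?case
    unfolding eq
    by (intro ce_in_ex ce_in_conj ce_in_all_less ce_in_imp ce_in_ce_set comp_intros
        comp_in_comp[OF comp_in_empty[OF f(1)]] 0[THEN comp_in_comp])
next
  case (Suc n)
  have M: "prob_space M" "sets M = sets borel" "computable_metric_space s"
    using assms(1) unfolding computable_probability_space_def by auto
  then interpret prob_space M by blast
  have sp: "space M = UNIV" using sets_eq_imp_space_eq[OF M(2)] by simp
  have meas: "Sigma_set s m i \<in> sets M" "- Sigma_set s m i \<in> sets M" for m i
    using borel_Sigma_set[of s m i] unfolding M(2) by auto
  obtain v where v: "comp_in {} v"
    "\<And>F. Sigma_set s (Suc n) (v F) = (\<Inter>i\<in>set_decode F. Sigma_set s (Suc n) i)"
    using Sigma_set_finite_Int[OF M(3)] by blast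
  have "ce_in (zero_jump n) (\<lambda>z. real (pfst z) / 2 ^ (pfst (psnd z)) <
      measure M (Sigma_set s (Suc n) (psnd (psnd z))))"
    by (intro Suc.IH comp_intros)
  from dec_in_not[OF dec_in_jump[OF this]]
  have "dec_in (zero_jump (Suc n)) (\<lambda>z. \<not> real (pfst z) / 2 ^ (pfst (psnd z)) <
      measure M (Sigma_set s (Suc n) (psnd (psnd z))))" unfolding zero_jump_Suc .
  note dec = dec_in_comp[OF this comp_in_pair[OF _ comp_in_pair], simplified prod_encode_inverse fst_conv snd_conv]
  have eq: "real a / 2 ^ N < measure M (Sigma_set s (Suc (Suc n)) e) \<longleftrightarrow>
    (\<exists>k. (\<forall>i<k. i \<in> set_decode k \<longrightarrow> i \<in> ce_set e) \<and>
      (\<exists>b K. \<not> real b / 2 ^ K < measure M (Sigma_set s (Suc n) (v k)) \<and>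
        b * 2 ^ N + a * 2 ^ K < 2 ^ (N + K)))" for a N e
  proof -
    have "measure M (\<Union>i\<in>set_decode k. - Sigma_set s (Suc n) i) =
        1 - measure M (Sigma_set s (Suc n) (v k))" for k
    proof -
      have "(\<Union>i\<in>set_decode k. - Sigma_set s (Suc n) i) = space M - Sigma_set s (Suc n) (v k)"
        unfolding v(2) sp by blast
      then show ?thesis using prob_compl[OF meas(1)] by simp
    qed
    moreover have "(\<forall>i<k. i \<in> set_decode k \<longrightarrow> i \<in> ce_set e) \<longleftrightarrow> set_decode k \<subseteq> ce_set e" for k
      using set_decode_less by blast
    ultimately show ?thesis
      using measure_UN_greater_iff[OF finite_measure_axioms, of "\<lambda>i. - Sigma_set s (Suc n) i"
          "real a / 2 ^ N" "ce_set e", OF meas(2)]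
      by (simp add: dyadic_gap_iff del: not_less)
  qed
  show ?case
    unfolding eq
    by (intro ce_in_ex ce_in_conj ce_in_all_less ce_in_imp ce_in_ce_set comp_intros
        Suc.prems[THEN comp_in_comp])
      (intro ce_in_dec dec comp_intros comp_in_comp[OF comp_in_empty[OF v(1)]]
        Suc.prems[THEN comp_in_comp])+
qed

section \<open>Lower semicomputable reals with a computable sum\<close>

text \<open>Finite lists as iterated pairs without a stored length: every number codes an infinite
  sequence, of which an initial part can be prescribed.\<close>

definition entry :: "nat \<Rightarrow> nat \<Rightarrow> nat" where
  "entry w i = pfst ((psnd ^^ i) w)"

lemma ex_entry: "\<exists>w. \<forall>i<n. entry w i = f i"
proof (induction n arbitrary: f)
  case (Suc n)
  from Suc.IH[of "\<lambda>i. f (Suc i)"] obtain w where w: "\<forall>i<n. entry w i = f (Suc i)" by blast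
  have "entry (prod_encode (f 0, w)) i = f i" if "i < Suc n" for i
    using that w by (cases i) (auto simp: entry_def funpow_Suc_right simp del: funpow.simps(2))
  then show ?case by blast
qed simp

lemma comp_in_entry:
  assumes "comp_in B f" "comp_in B g"
  shows "comp_in B (\<lambda>x. entry (f x) (g x))"
proof -
  have "(psnd ^^ i) w = rec_nat w (\<lambda>_ r. psnd r) i" for i w by (induction i) auto
  then show ?thesis
    unfolding entry_def by (simp only:) (intro comp_intros comp_in_rec assms)
qed

text \<open>
  Lower approximations of the other terms bound the last term from above through the sum.
\<close>

lemma comp_in_approx_last_term:
  fixes r :: "nat \<Rightarrow> nat \<Rightarrow> real"
  assumes lower: "ce_in B (\<lambda>z. real (pfst (psnd (psnd z))) / 2 ^ psnd (psnd (psnd z)) <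
      r (pfst z) (pfst (psnd z)))"
    and upper: "ce_in B (\<lambda>z. t < real (pfst z) / 2 ^ psnd z)"
    and nonneg: "0 \<le> t" "\<And>m i. 0 \<le> r m i"
    and sum: "\<And>m. (\<Sum>i<Suc m. r m i) = 1 + real m * t"
  obtains f where "comp_in B (\<lambda>z. f (pfst z) (psnd z))"
    "\<And>m p. \<bar>rat_enum (f m p) - r m m\<bar> \<le> (1/2) ^ p"
proof -
  \<comment> \<open>\<open>z\<close> codes the row \<open>m\<close> and the precision
    \<open>p\<close>; \<open>y\<close> codes numerators of lower bounds, a common exponent
    \<open>N\<close> and the numerator of an upper bound of \<open>t\<close>. The last condition
    says that these bounds miss the identity for the sum by at most \<open>(1/2) ^ p\<close>. The
    entry 0 is always allowed, since a term may vanish.\<close>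
  define R where "R z y \<longleftrightarrow>
    (\<forall>i<Suc (pfst z). entry (pfst y) i = 0 \<or>
      real (entry (pfst y) i) / 2 ^ pfst (psnd y) < r (pfst z) i) \<and>
    t < real (psnd (psnd y)) / 2 ^ pfst (psnd y) \<and>
    (2 ^ pfst (psnd y) + pfst z * psnd (psnd y)) * 2 ^ psnd z \<le>
      (\<Sum>i<Suc (pfst z). entry (pfst y) i) * 2 ^ psnd z + 2 ^ pfst (psnd y)" for z y
  have lower': "ce_in B (\<lambda>z. real (a z) / 2 ^ N z < r (m z) (i z))"
    if "comp_in B a" "comp_in B N" "comp_in B m" "comp_in B i" for a N m i
    using ce_in_comp[OF lower, of "\<lambda>z. prod_encode (m z, prod_encode (i z, prod_encode (a z, N z)))"]
      that by (simp add: comp_in_pair)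
  have "ce_in B (\<lambda>z. R (pfst z) (psnd z))"
    unfolding R_def
    by (intro ce_in_conj ce_in_all_less ce_in_disj lower' comp_intros comp_in_entry
        ce_in_comp2[OF upper])
      (intro ce_in_dec comp_intros comp_in_entry)+
  moreover have "\<exists>y. R z y" for z
  proof -
    define m where "m = pfst z"
    define p where "p = psnd z"
    \<comment> \<open>Rounding costs at most one unit \<open>1 / 2 ^ N\<close> for each of the
      \<open>m + 1\<close> entries and for each of the \<open>m\<close> copies of the upper bound.
      The total \<open>(2 * m + 1) / 2 ^ N\<close> is at most \<open>(1/2) ^ p\<close>.\<close>
    define N where "N = 2 * m + 1 + p"
    \<comment> \<open>The largest integer strictly below the scaled term, with -1 cut off to 0 if
      the term is 0.\<close>
    obtain w where w: "\<forall>i<Suc m. entry w i = nat (\<lceil>r m i * 2 ^ N\<rceil> - 1)"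
      using ex_entry[of "Suc m" "\<lambda>i. nat (\<lceil>r m i * 2 ^ N\<rceil> - 1)"] by blast
    define h where "h = nat (\<lfloor>t * 2 ^ N\<rfloor> + 1)"
    have "0 \<le> t * 2 ^ N" using nonneg by simp
    then have h: "t * 2 ^ N < real h" "real h \<le> t * 2 ^ N + 1"
      unfolding h_def by (auto simp: of_nat_nat)
    have e: "entry w i = 0 \<or> real (entry w i) < r m i * 2 ^ N" "r m i * 2 ^ N - 1 \<le> real (entry w i)"
      if "i < Suc m" for i
    proof -
      have "entry w i = nat (\<lceil>r m i * 2 ^ N\<rceil> - 1)" using w that by blast
      then show "entry w i = 0 \<or> real (entry w i) < r m i * 2 ^ N"
          "r m i * 2 ^ N - 1 \<le> real (entry w i)"
        by linarith+
    qed
    have "R z (prod_encode (w, prod_encode (N, h)))"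
      unfolding R_def prod_encode_inverse fst_conv snd_conv m_def[symmetric] p_def[symmetric]
    proof (intro conjI allI impI)
      fix i assume "i < Suc m"
      from e(1)[OF this] show "entry w i = 0 \<or> real (entry w i) / 2 ^ N < r m i"
        by (simp add: field_simps)
    next
      show "t < real h / 2 ^ N" using h(1) by (simp add: field_simps)
    next
      have "(\<Sum>i<Suc m. r m i * 2 ^ N - 1) \<le> (\<Sum>i<Suc m. real (entry w i))"
        by (rule sum_mono) (use e(2) in auto)
      then have "(1 + real m * t) * 2 ^ N - real (Suc m) \<le> (\<Sum>i<Suc m. real (entry w i))"
        unfolding sum[symmetric] sum_subtractf sum_distrib_right by simp
      moreover have "real m * real h \<le> real m * (t * 2 ^ N + 1)"
        using h(2) by (rule mult_left_mono) simp
      ultimately have "2 ^ N + real m * real h \<le> (\<Sum>i<Suc m. real (entry w i)) + (2 * real m + 1)"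
        by (simp add: algebra_simps)
      then have "(2 ^ N + real m * real h) * 2 ^ p \<le>
          ((\<Sum>i<Suc m. real (entry w i)) + (2 * real m + 1)) * 2 ^ p"
        by (rule mult_right_mono) simp
      also have "\<dots> = (\<Sum>i<Suc m. real (entry w i)) * 2 ^ p + real (2 * m + 1) * 2 ^ p"
        by (simp add: algebra_simps)
      also have "real (2 * m + 1) * 2 ^ p \<le> 2 ^ (2 * m + 1) * 2 ^ p"
        by (intro mult_right_mono less_imp_le of_nat_less_two_power) simp
      also have "\<dots> = 2 ^ N" unfolding N_def by (simp add: power_add)
      finally have "real ((2 ^ N + m * h) * 2 ^ p) \<le>
          real ((\<Sum>i<Suc m. entry w i) * 2 ^ p + 2 ^ N)" by simp
      then show "(2 ^ N + m * h) * 2 ^ p \<le> (\<Sum>i<Suc m. entry w i) * 2 ^ p + 2 ^ N"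
        by (simp only: of_nat_le_iff)
    qed
    then show ?thesis by blast
  qed
  ultimately obtain F where F: "comp_in B F" "\<And>z. R z (F z)" by (rule ce_in_select) blast
  define f where "f m p = (let y = F (prod_encode (m, p)) in
      prod_encode (2 * entry (pfst y) m, 2 ^ pfst (psnd y) - 1))" for m p
  have "comp_in B (\<lambda>z. f (pfst z) (psnd z))"
    unfolding f_def Let_def by (intro comp_intros comp_in_entry comp_in_comp[OF F(1)])
  moreover have "\<bar>rat_enum (f m p) - r m m\<bar> \<le> (1/2) ^ p" for m p
  proof -
    define y where "y = F (prod_encode (m, p))"
    define w where "w = pfst y"
    define N where "N = pfst (psnd y)"
    define h where "h = psnd (psnd y)"
    have R: "\<And>i. i < Suc m \<Longrightarrow> entry w i = 0 \<or> real (entry w i) / 2 ^ N < r m i"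
        "t < real h / 2 ^ N"
        "(2 ^ N + m * h) * 2 ^ p \<le> (\<Sum>i<Suc m. entry w i) * 2 ^ p + 2 ^ N"
      using F(2)[of "prod_encode (m, p)"]
      unfolding R_def y_def[symmetric] w_def N_def h_def prod_encode_inverse fst_conv snd_conv
      by blast+
    have le: "real (entry w i) / 2 ^ N \<le> r m i" if "i < Suc m" for i
      using R(1)[OF that] nonneg(2)[of m i] by auto
    have "real ((2 ^ N + m * h) * 2 ^ p) \<le> real ((\<Sum>i<Suc m. entry w i) * 2 ^ p + 2 ^ N)"
      using R(3) by (simp only: of_nat_le_iff)
    then have bound: "(2 ^ N + real m * real h) * 2 ^ p \<le>
        (\<Sum>i<Suc m. real (entry w i)) * 2 ^ p + 2 ^ N"
      by simp
    have "1 + a * (b / X) \<le> e / X + 1 / Y" if "(X + a * b) * Y \<le> e * Y + X" "X > 0" "Y > 0"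
      for a b e X Y :: real
    proof -
      have "(X + a * b) * Y / (X * Y) \<le> (e * Y + X) / (X * Y)"
        using that by (intro divide_right_mono) auto
      then show ?thesis using that(2,3) by (simp add: add_divide_distrib)
    qed
    from this[OF bound]
    have "1 + real m * (real h / 2 ^ N) \<le> (\<Sum>i<Suc m. real (entry w i)) / 2 ^ N + (1/2) ^ p"
      by (simp add: power_one_over)
    moreover have "real m * t \<le> real m * (real h / 2 ^ N)"
      using R(2) by (intro mult_left_mono) simp_all
    moreover have "(\<Sum>i<Suc m. r m i) = (\<Sum>i<m. r m i) + r m m" by simp
    moreover have "(\<Sum>i<m. real (entry w i) / 2 ^ N) \<le> (\<Sum>i<m. r m i)"
      by (rule sum_mono) (use le in simp)
    moreover have "(\<Sum>i<Suc m. real (entry w i)) / 2 ^ N =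
        (\<Sum>i<m. real (entry w i) / 2 ^ N) + real (entry w m) / 2 ^ N"
      by (simp add: sum_divide_distrib add_divide_distrib)
    \<comment> \<open>In the estimate for the whole sum, the lower bounds of the first
      \<open>m\<close> terms are at most these terms and cancel, so the error falls on the last term
      alone.\<close>
    ultimately have "r m m \<le> real (entry w m) / 2 ^ N + (1/2) ^ p"
      using sum[of m] by linarith
    moreover have "rat_enum (f m p) = real (entry w m) / 2 ^ N"
      unfolding f_def Let_def y_def[symmetric] w_def N_def by (rule rat_enum_dyadic)
    moreover have "0 \<le> (1/2 :: real) ^ p" by simp
    ultimately show ?thesis using le[of m] by auto
  qed
  ultimately show thesis using that by blast
qed

text \<open>\<open>1 - t < u\<close> holds iff some approximation \<open>v\<close> of
  \<open>t\<close> with error bound \<open>(1/2) ^ q\<close> satisfies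
  \<open>1 + (1/2) ^ q < v + u\<close>. In the application \<open>1 - t\<close> is the measure of
  the complement.\<close>

lemma ce_in_computable_real_upper:
  assumes "computable_real_in B t" "0 < t"
  shows "ce_in B (\<lambda>z. 1 - t < real (pfst z) / 2 ^ psnd z)"
proof -
  obtain e where e: "\<And>q. \<exists>j. phi B e q = Some j \<and> \<bar>rat_enum j - t\<bar> \<le> (1/2) ^ q"
    using assms(1) unfolding computable_real_in_def computable_real_index_def by blast
  have appr: "\<exists>j. phi B e q = Some j \<and> \<bar>real (rat_num j) / real (Suc (psnd j)) - t\<bar> \<le> (1/2) ^ q" for q
    using e[of q] rat_num_approx[of t _ "(1/2) ^ q"] assms(2) by fastforce
  have eq: "1 - t < real h / 2 ^ N \<longleftrightarrow> (\<exists>q j. phi B e q = Some j \<and>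
      Suc (psnd j) * 2 ^ N * 2 ^ q + Suc (psnd j) * 2 ^ N <
      rat_num j * 2 ^ N * 2 ^ q + h * Suc (psnd j) * 2 ^ q)" for h N
  proof -
    have *: "Suc (psnd j) * 2 ^ N * 2 ^ q + Suc (psnd j) * 2 ^ N <
          rat_num j * 2 ^ N * 2 ^ q + h * Suc (psnd j) * 2 ^ q \<longleftrightarrow>
        1 + (1/2) ^ q < real (rat_num j) / real (Suc (psnd j)) + real h / 2 ^ N" for q j
    proof -
      have "1 + (1/2) ^ q < a / d + b / u \<longleftrightarrow> d * u * v + d * u < a * u * v + b * d * v"
        if "d > 0" "u > 0" "v = 2 ^ q" for a b d u v :: real
        using that by (simp add: field_simps power_one_over)
      from this[of "real (Suc (psnd j))" "2 ^ N" "2 ^ q" "real (rat_num j)" "real h"]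
      show ?thesis
        unfolding of_nat_less_iff[where 'a=real, symmetric] of_nat_add of_nat_mult of_nat_power
          of_nat_numeral by simp
    qed
    show ?thesis unfolding *
    proof
      assume "1 - t < real h / 2 ^ N"
      then have "(t + real h / 2 ^ N - 1) / 2 > 0" by simp
      then obtain q where q: "(1/2) ^ q < (t + real h / 2 ^ N - 1) / 2"
        using power_half_less by blast
      obtain j where j: "phi B e q = Some j"
          "\<bar>real (rat_num j) / real (Suc (psnd j)) - t\<bar> \<le> (1/2) ^ q" using appr by blast
      have "1 + p < v + u" if "\<bar>v - t\<bar> \<le> p" "p < (t + u - 1) / 2" for p u v :: real
        using that by (simp add: field_simps)
      from this[OF j(2) q] j(1)
      show "\<exists>q j. phi B e q = Some j \<and>
          1 + (1/2) ^ q < real (rat_num j) / real (Suc (psnd j)) + real h / 2 ^ N" by blast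
    next
      assume "\<exists>q j. phi B e q = Some j \<and>
          1 + (1/2) ^ q < real (rat_num j) / real (Suc (psnd j)) + real h / 2 ^ N"
      then obtain q j where j: "phi B e q = Some j"
          "1 + (1/2) ^ q < real (rat_num j) / real (Suc (psnd j)) + real h / 2 ^ N" by blast
      have "\<bar>real (rat_num j) / real (Suc (psnd j)) - t\<bar> \<le> (1/2) ^ q"
        using appr[of q] j(1) by auto
      moreover have "1 - t < u" if "\<bar>v - t\<bar> \<le> p" "1 + p < v + u" for p u v :: real
        using that by simp
      ultimately show "1 - t < real h / 2 ^ N" using j(2) by blast
    qed
  qed
  show ?thesis
    unfolding eq
    by (intro ce_in_ex ce_in_conj ce_in_phi comp_intros)
      (intro ce_in_dec comp_intros comp_in_rat_num)
qed

section \<open>Avoiding a set of positive measure\<close>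

lemma measure_avoiding_tendsto_0:
  assumes "prob_space M" "sets M = sets borel" "measure_preserving_on M D T" "ergodic_on M D T"
    and A: "A \<in> sets borel" "measure M A > 0"
  shows "(\<lambda>m. measure M {y\<in>D. \<forall>k. 0 < k \<and> k \<le> m \<longrightarrow> (T ^^ k) y \<notin> A}) \<longlonglongrightarrow> 0"
proof -
  interpret prob_space M by fact
  have sp: "space M = UNIV" using sets_eq_imp_space_eq[OF assms(2)] by simp
  have T: "\<And>B. B \<in> sets borel \<Longrightarrow> T -` B \<inter> D \<in> sets borel"
      "\<And>B. B \<in> sets borel \<Longrightarrow> measure M (T -` B \<inter> D) = measure M B"
      "\<And>y. y \<in> D \<Longrightarrow> T y \<in> D"
    using assms(3) unfolding measure_preserving_on_def by blast+
  have D: "D \<in> sets borel" using T(1)[of UNIV] by simp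
  have "measure M D = 1" using T(2)[of UNIV] prob_space sp by simp
  define P where "P k = {y\<in>D. (T ^^ k) y \<in> A}" for k
  have P_Suc: "P (Suc k) = T -` P k \<inter> D" for k
    unfolding P_def by (auto simp: funpow_Suc_right T(3) simp del: funpow.simps(2))
  have P0: "P 0 = A \<inter> D" unfolding P_def by auto
  have P: "P k \<in> sets borel \<and> measure M (P k) = measure M A" for k
  proof (induction k)
    case 0
    have "measure M (A \<inter> D) = measure M A"
    proof -
      have "measure M (A \<inter> D) = measure M A - measure M (A - D)"
        using finite_measure_Diff'[of A D] A(1) D assms(2) by simp
      moreover have "measure M (A - D) \<le> measure M (space M - D)"
        using A(1) D assms(2) sp by (intro finite_measure_mono) auto
      moreover have "measure M (space M - D) = 0"
        using prob_compl[of D] D assms(2) \<open>measure M D = 1\<close> by simp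
      ultimately show ?thesis using measure_nonneg[of M "A - D"] by linarith
    qed
    with A D show ?case unfolding P0 by simp
  next
    case (Suc k)
    then show ?case unfolding P_Suc using T by auto
  qed
  \<comment> \<open>Visits to \<open>A\<close> at time \<open>j\<close> or later. These sets
    decrease and contain \<open>P j\<close>, so their intersection \<open>C\<close>, the points with
    infinitely many visits, has measure at least that of \<open>A\<close>.\<close>
  define G where "G j = (\<Union>k\<in>{j..}. P k)" for j
  have G: "G j \<in> sets borel" for j unfolding G_def using P by blast
  define C where "C = (\<Inter>j. G j)"
  have "(\<lambda>j. measure M (G j)) \<longlonglongrightarrow> measure M C"
    unfolding C_def
  proof (rule finite_Lim_measure_decseq)
    show "decseq G" unfolding decseq_def G_def by (intro allI impI UN_mono) auto
  qed (use G assms(2) in auto)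
  moreover have "measure M A \<le> measure M (G j)" for j
  proof -
    have "measure M (P j) \<le> measure M (G j)"
      using G P assms(2) by (intro finite_measure_mono) (auto simp: G_def)
    then show ?thesis using P by simp
  qed
  ultimately have "measure M A \<le> measure M C" by (meson LIMSEQ_le_const)
  then have "measure M C \<noteq> 0" using A(2) by simp
  have C: "C \<in> sets borel" unfolding C_def using G by blast
  have C_iff: "y \<in> C \<longleftrightarrow> y \<in> D \<and> (\<forall>j. \<exists>k\<ge>j. (T ^^ k) y \<in> A)" for y
    unfolding C_def G_def P_def by auto
  \<comment> \<open>Infinitely many visits are unaffected by a shift of time, so the invariance is
    exact, as \<open>ergodic_on\<close> demands.\<close>
  have "T -` C \<inter> D = C"
  proof (intro set_eqI)
    fix y
    have "(\<forall>j. \<exists>k\<ge>j. (T ^^ k) (T y) \<in> A) \<longleftrightarrow> (\<forall>j. \<exists>k\<ge>j. (T ^^ k) y \<in> A)"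
    proof
      assume *: "\<forall>j. \<exists>k\<ge>j. (T ^^ k) (T y) \<in> A"
      show "\<forall>j. \<exists>k\<ge>j. (T ^^ k) y \<in> A"
      proof
        fix j
        from * obtain k where "k \<ge> j" "(T ^^ k) (T y) \<in> A" by blast
        then show "\<exists>k\<ge>j. (T ^^ k) y \<in> A"
          by (intro exI[of _ "Suc k"]) (simp add: funpow_Suc_right del: funpow.simps(2))
      qed
    next
      assume *: "\<forall>j. \<exists>k\<ge>j. (T ^^ k) y \<in> A"
      show "\<forall>j. \<exists>k\<ge>j. (T ^^ k) (T y) \<in> A"
      proof
        fix j
        \<comment> \<open>\<open>Suc j\<close> keeps \<open>k\<close> positive, so that the time can
          be shifted back by one.\<close>
        from * obtain k where k: "k \<ge> Suc j" "(T ^^ k) y \<in> A" by blast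
        then obtain l where "k = Suc l" by (cases k) auto
        with k show "\<exists>k\<ge>j. (T ^^ k) (T y) \<in> A"
          by (intro exI[of _ l]) (simp add: funpow_Suc_right del: funpow.simps(2))
      qed
    qed
    then show "y \<in> T -` C \<inter> D \<longleftrightarrow> y \<in> C" using T(3) by (auto simp: C_iff)
  qed
  with \<open>measure M C \<noteq> 0\<close> have "measure M C = 1"
    using assms(4) C unfolding ergodic_on_def by blast
  let ?V = "\<lambda>m. {y\<in>D. \<forall>k. 0 < k \<and> k \<le> m \<longrightarrow> (T ^^ k) y \<notin> A}"
  have V_eq: "?V m = D - (\<Union>k\<in>{1..m}. P k)" for m unfolding P_def by auto
  have V: "?V m \<in> sets M" for m unfolding V_eq assms(2) using P D by blast
  have "(\<lambda>m. measure M (?V m)) \<longlonglongrightarrow> measure M (\<Inter>m. ?V m)"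
  proof (rule finite_Lim_measure_decseq)
    show "range ?V \<subseteq> sets M" using V by (rule image_subsetI)
    show "decseq ?V" unfolding decseq_def by (intro allI impI Collect_mono) (meson order_trans)
  qed
  moreover have "measure M (\<Inter>m. ?V m) \<le> measure M (space M - C)"
  proof (rule finite_measure_mono)
    have "y \<notin> C" if y: "y \<in> (\<Inter>m. ?V m)" for y
    proof
      assume "y \<in> C"
      then obtain k where "k \<ge> 1" "(T ^^ k) y \<in> A" unfolding C_iff by blast
      moreover have "y \<in> ?V k" using y by blast
      ultimately show False by auto
    qed
    then show "(\<Inter>m. ?V m) \<subseteq> space M - C" unfolding sp by blast
  qed (use C assms(2) in auto)
  moreover have "measure M (space M - C) = 0"
    using prob_compl[of C] C assms(2) \<open>measure M C = 1\<close> by simp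
  ultimately show ?thesis using measure_nonneg[of M "\<Inter>m. ?V m"] by simp
qed

section \<open>The Schnorr test of avoiding sets\<close>

theorem theorem3p2:
  fixes s :: "nat \<Rightarrow> 'a::polish_space" and M :: "'a measure" and n :: nat
    and x :: 'a and A :: "'a set" and D :: "'a set" and T :: "'a \<Rightarrow> 'a"
  assumes "computable_probability_space s M"
    and "n \<ge> 1"
    and "Schnorr_random s M n x"
    and "is_Pi s n A"
    and "measure M A > 0"
    and "computable_real_in (zero_jump (n - 1)) (measure M A)"
    and "measure_preserving_on M D T"
    and "computable_map_on s D T"
    and "ergodic_on M D T"
    and "x \<in> D"
  shows "\<exists>k>0. (T ^^ k) x \<in> A"
proof (rule ccontr)
  assume avoid: "\<not> (\<exists>k>0. (T ^^ k) x \<in> A)"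
  obtain l where n: "n = Suc l" using assms(2) by (cases n) auto
  define B where "B = zero_jump l"
  let ?S = "Sigma_set s (Suc l)"
  have M: "prob_space M" "sets M = sets borel" "computable_metric_space s"
    using assms(1) unfolding computable_probability_space_def by auto
  interpret prob_space M by (rule M(1))
  have sp: "space M = UNIV" using sets_eq_imp_space_eq[OF M(2)] by simp
  have S: "?S e \<in> sets M" for e unfolding M(2) by (rule borel_Sigma_set)
  have T: "\<And>B. B \<in> sets borel \<Longrightarrow> T -` B \<inter> D \<in> sets borel"
      "\<And>B. B \<in> sets borel \<Longrightarrow> measure M (T -` B \<inter> D) = measure M B"
      "\<And>y. y \<in> D \<Longrightarrow> T y \<in> D"
    using assms(7) unfolding measure_preserving_on_def by blast+
  have D: "D \<in> sets M" using T(1)[of UNIV] M(2) by simp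
  have D1: "measure M D = 1" using T(2)[of UNIV] prob_space sp by simp

  \<comment> \<open>Uniform indices of the avoiding sets\<close>
  obtain u where u: "- A = ?S u" using assms(4) unfolding is_Pi_def n by blast
  have A_eq: "A = space M - ?S u" using u unfolding sp by blast
  have A: "A \<in> sets borel" using S[of u] unfolding A_eq M(2)[symmetric] by blast
  have mu: "measure M (?S u) = 1 - measure M A"
    using prob_compl[OF S[of u]] unfolding A_eq by simp
  obtain g where g: "comp_in {} g" "\<And>a b. ?S (g (prod_encode (a, b))) = ?S a \<inter> ?S b"
    using Sigma_set_Int[OF M(3), of l] by blast
  obtain v where v: "comp_in {} v" "\<And>a b. ?S (v (prod_encode (a, b))) = ?S a \<union> ?S b"
    using Sigma_set_Un[of s l] by blast
  obtain t where t: "comp_in {} t" "\<And>e. D \<inter> ?S (t e) = D \<inter> T -` ?S e"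
    using Sigma_set_vimage[OF assms(8), of l] by blast
  obtain e0 where e0: "?S e0 = UNIV" by (rule Sigma_set_UNIV)
  \<comment> \<open>Indices of the sets of points avoiding \<open>A\<close> at the times 1 to
    \<open>m\<close>. They are known only on \<open>D\<close>; as \<open>D\<close> has full measure,
    \<open>meas_D\<close> transfers all measures.\<close>
  define w where "w m = rec_nat e0 (\<lambda>_ r. t (g (prod_encode (u, r)))) m" for m
  have w_comp: "comp_in C w" for C
    unfolding w_def
    by (intro comp_in_rec comp_intros comp_in_comp[OF comp_in_empty[OF t(1)]]
        comp_in_comp[OF comp_in_empty[OF g(1)]])
  have w_0: "?S (w 0) = UNIV" by (simp add: w_def e0)
  have w_Suc: "D \<inter> ?S (w (Suc m)) = D \<inter> T -` (?S u \<inter> ?S (w m))" for m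
    by (simp add: w_def t(2) g(2))
  have w_iff: "y \<in> D \<Longrightarrow> y \<in> ?S (w m) \<longleftrightarrow> (\<forall>k. 0 < k \<and> k \<le> m \<longrightarrow> (T ^^ k) y \<notin> A)" for y m
  proof (induction m arbitrary: y)
    case (Suc m)
    have "y \<in> ?S (w (Suc m)) \<longleftrightarrow> T y \<in> ?S u \<and> T y \<in> ?S (w m)"
      using w_Suc[of m] Suc.prems by blast
    also have "\<dots> \<longleftrightarrow> T y \<notin> A \<and> (\<forall>k. 0 < k \<and> k \<le> m \<longrightarrow> (T ^^ Suc k) y \<notin> A)"
      using Suc.IH[OF T(3)[OF Suc.prems]] u
      by (auto simp: funpow_Suc_right simp del: funpow.simps(2))
    also have "\<dots> \<longleftrightarrow> (\<forall>k. 0 < k \<and> k \<le> Suc m \<longrightarrow> (T ^^ k) y \<notin> A)"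
    proof (intro iffI allI impI)
      fix k assume *: "T y \<notin> A \<and> (\<forall>k. 0 < k \<and> k \<le> m \<longrightarrow> (T ^^ Suc k) y \<notin> A)"
        and k: "0 < k \<and> k \<le> Suc m"
      then obtain j where "k = Suc j" by (cases k) auto
      with * k show "(T ^^ k) y \<notin> A" by (cases j) auto
    next
      assume *: "\<forall>k. 0 < k \<and> k \<le> Suc m \<longrightarrow> (T ^^ k) y \<notin> A"
      then have "(T ^^ Suc k) y \<notin> A" if "k \<le> m" for k using that by blast
      from this[of 0] this
      show "T y \<notin> A \<and> (\<forall>k. 0 < k \<and> k \<le> m \<longrightarrow> (T ^^ Suc k) y \<notin> A)" by auto
    qed
    finally show ?case .
  qed (simp add: w_0)
  have x_in: "x \<in> ?S (w m)" for m using w_iff[OF assms(10)] avoid by blast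

  \<comment> \<open>Measures of the avoiding sets\<close>
  define c where "c m = measure M (?S (w m))" for m
  have meas_D: "measure M (D \<inter> E) = measure M E" if "E \<in> sets M" for E
  proof -
    have "measure M (E - D) \<le> measure M (space M - D)"
      using sp by (intro finite_measure_mono sets.compl_sets D) auto
    also have "\<dots> = 0" using prob_compl[OF D] D1 by simp
    finally have "measure M (E - D) = 0" using measure_nonneg[of M "E - D"] by linarith
    then show ?thesis using finite_measure_Diff'[OF that D] by (simp add: Int_commute)
  qed
  \<comment> \<open>The intersection is traded for a union. In \<open>c_sum\<close> all unknown
    measures then stand on one side with positive sign, so that lower bounds suffice.\<close>
  have c_Suc: "c (Suc m) = measure M (?S u) + c m - measure M (?S (v (prod_encode (u, w m))))" for m
  proof -
    have UI: "?S u \<inter> ?S (w m) \<in> sets M" using S by blast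
    have "c (Suc m) = measure M (T -` (?S u \<inter> ?S (w m)) \<inter> D)"
      unfolding c_def using meas_D[OF S[of "w (Suc m)"]] w_Suc[of m] by (simp add: Int_commute)
    also have "\<dots> = measure M (?S u \<inter> ?S (w m))"
      using T(2) UI unfolding M(2) by blast
    also have "\<dots> = measure M (?S u) + c m - measure M (?S u \<union> ?S (w m))"
      unfolding c_def using finite_measure_Union'[OF S[of u] S[of "w m"]]
        finite_measure_Diff'[OF S[of "w m"] S[of u]] by (simp add: Int_commute)
    finally show ?thesis unfolding v(2) .
  qed
  have c_sum: "c m + (\<Sum>i<m. measure M (?S (v (prod_encode (u, w i))))) =
      1 + real m * measure M (?S u)" for m
  proof (induction m)
    case 0
    show ?case using prob_space unfolding c_def w_0 sp by simp
  next
    case (Suc m)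
    then show ?case using c_Suc[of m] by (simp add: algebra_simps)
  qed
  have c_lim: "c \<longlonglongrightarrow> 0"
  proof -
    have "{y\<in>D. \<forall>k. 0 < k \<and> k \<le> m \<longrightarrow> (T ^^ k) y \<notin> A} = D \<inter> ?S (w m)" for m
      using w_iff by blast
    with measure_avoiding_tendsto_0[OF M(1,2) assms(7,9) A assms(5)] meas_D[OF S]
    show ?thesis unfolding c_def by simp
  qed

  \<comment> \<open>Row \<open>m\<close> lists the \<open>m\<close> measures of unions and then
    \<open>c m\<close>. The case distinction is made on the index of the set, so that
    \<open>ce_in_measure_Sigma_set\<close> covers all entries uniformly.\<close>
  define r where
    "r m i = measure M (?S (if i < m then v (prod_encode (u, w i)) else w m))" for m i
  have r_diag: "r m m = c m" for m unfolding r_def c_def by simp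
  have "ce_in B (\<lambda>z. real (pfst (psnd (psnd z))) / 2 ^ psnd (psnd (psnd z)) <
      r (pfst z) (pfst (psnd z)))"
    unfolding r_def B_def
    by (intro ce_in_measure_Sigma_set[OF assms(1)] comp_intros comp_in_comp[OF w_comp]
        comp_in_comp[OF comp_in_empty[OF v(1)]])
  moreover have "ce_in B (\<lambda>z. measure M (?S u) < real (pfst z) / 2 ^ psnd z)"
    unfolding mu using ce_in_computable_real_upper assms(5,6) unfolding n B_def by simp
  moreover have "(\<Sum>i<Suc m. r m i) = 1 + real m * measure M (?S u)" for m
    using c_sum[of m] r_diag[of m] by (simp add: r_def)
  ultimately obtain apx where apx: "comp_in B (\<lambda>z. apx (pfst z) (psnd z))"
      "\<And>m p. \<bar>rat_enum (apx m p) - c m\<bar> \<le> (1/2) ^ p"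
    using comp_in_approx_last_term[of B r "measure M (?S u)"] r_diag
    by (metis r_def measure_nonneg)
  have apx_comp: "comp_in B (\<lambda>z. apx (a z) (b z))" if "comp_in B a" "comp_in B b" for a b
    using comp_in_comp[OF apx(1) comp_in_pair[OF that]] by simp

  \<comment> \<open>Fast convergence along an oracle-computable sequence\<close>
  define val where "val m p = real (rat_num (apx m p)) / real (Suc (psnd (apx m p)))" for m p
  have val: "\<bar>val m p - c m\<bar> \<le> (1/2) ^ p" for m p
    unfolding val_def by (rule rat_num_approx[OF _ apx(2)]) (simp add: c_def)
  \<comment> \<open>An approximation within \<open>(1/2) ^ (k + 2)\<close> is tested against
    \<open>(1/2) ^ (k + 1)\<close>. This is decidable in \<open>B\<close>, holds as soon as
    \<open>c m < (1/2) ^ (k + 2)\<close>, and implies \<open>c m \<le> (1/2) ^ k\<close>.\<close>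
  define Q where "Q k m \<longleftrightarrow>
      rat_num (apx m (k + 2)) * 2 ^ (k + 1) \<le> Suc (psnd (apx m (k + 2)))" for k m
  have Q_iff: "Q k m \<longleftrightarrow> val m (k + 2) \<le> (1/2) ^ (k + 1)" for k m
  proof -
    have "Q k m \<longleftrightarrow> real (rat_num (apx m (k + 2)) * 2 ^ (k + 1)) \<le> real (Suc (psnd (apx m (k + 2))))"
      unfolding Q_def of_nat_le_iff ..
    also have "\<dots> \<longleftrightarrow> val m (k + 2) \<le> (1/2) ^ (k + 1)"
      unfolding val_def by (simp add: field_simps power_one_over del: of_nat_Suc)
    finally show ?thesis .
  qed
  have "ce_in B (\<lambda>z. Q (pfst z) (psnd z))"
    unfolding Q_def by (intro ce_in_dec comp_intros comp_in_rat_num apx_comp)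
  moreover have "\<exists>m. Q k m" for k
  proof -
    have "\<forall>\<^sub>F m in sequentially. c m < (1/2) ^ (k + 2)"
      using c_lim by (rule order_tendstoD) simp
    then obtain m where "c m < (1/2) ^ (k + 2)" unfolding eventually_sequentially by blast
    moreover have "(1/2 :: real) ^ (k + 1) = (1/2) ^ k / 2" "(1/2 :: real) ^ (k + 2) = (1/2) ^ k / 4"
      by simp_all
    ultimately have "val m (k + 2) \<le> (1/2) ^ (k + 1)"
      using val[of m "k + 2"] unfolding abs_le_iff by linarith
    then show ?thesis unfolding Q_iff by blast
  qed
  ultimately obtain F where F: "comp_in B F" "\<And>k. Q k (F k)" by (rule ce_in_select) blast
  have c_F: "c (F k) \<le> (1/2) ^ k" for k
  proof -
    have "val (F k) (k + 2) \<le> (1/2) ^ (k + 1)" using F(2) unfolding Q_iff .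
    moreover have "(1/2 :: real) ^ (k + 1) = (1/2) ^ k / 2" "(1/2 :: real) ^ (k + 2) = (1/2) ^ k / 4"
      by simp_all
    moreover have "(1/2 :: real) ^ k \<ge> 0" by simp
    ultimately show ?thesis using val[of "F k" "k + 2"] unfolding abs_le_iff by linarith
  qed

  \<comment> \<open>\<open>F\<close> is computable only in \<open>B\<close>, while the test requires
    computable indices. The graph of \<open>F\<close> is therefore built into the sets by
    indicators: all \<open>m\<close> are united, and only \<open>m = F k\<close>
    contributes.\<close>
  have "ce_in B (\<lambda>z. psnd z = F (pfst z))"
    by (intro ce_in_dec comp_intros comp_in_comp[OF F(1)])
  then obtain h where h: "comp_in {} h" "\<And>z. ?S (h z) = (if psnd z = F (pfst z) then UNIV else {})"
    unfolding B_def using Sigma_set_indicator[of l _ s] by blast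
  have "ce_in {} (\<lambda>z. \<exists>m. psnd z = g (prod_encode (w m, h (prod_encode (pfst z, m)))))"
    by (intro ce_in_ex ce_in_dec comp_intros comp_in_comp[OF g(1)] comp_in_comp[OF h(1)]
        comp_in_comp[OF w_comp])
  from Sigma_set_Union_ce[of "\<lambda>k e. \<exists>m. e = g (prod_encode (w m, h (prod_encode (k, m))))" s l, OF this]
  obtain q where q: "comp_in {} q" "\<And>k. ?S (q k) =
      (\<Union>e\<in>{e. \<exists>m. e = g (prod_encode (w m, h (prod_encode (k, m))))}. ?S e)" by blast
  have q_eq: "?S (q k) = ?S (w (F k))" for k
  proof -
    have "?S (q k) = (\<Union>m. ?S (w m) \<inter> ?S (h (prod_encode (k, m))))"
      unfolding q(2) g(2)[symmetric] by blast
    then show ?thesis unfolding h(2) by (auto split: if_splits)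
  qed

  \<comment> \<open>The approximations use the oracle, but the index \<open>a k\<close> of the
    program computing them depends computably on \<open>k\<close> without it.\<close>
  have "comp_in B (\<lambda>z. apx (F (pfst z)) (psnd z))"
    by (intro apx_comp comp_intros comp_in_comp[OF F(1)])
  then obtain a where a: "comp_in {} a" "\<And>k p. phi B (a k) p = Some (apx (F k) p)"
    by (rule comp_in_index[of B "\<lambda>k p. apx (F k) p"]) (rule that)
  have "Schnorr_test s M n (\<lambda>k. ?S (q k))"
    unfolding Schnorr_test_def
  proof (intro conjI allI)
    show "uniformly (\<lambda>k e. ?S (q k) = Sigma_set s n e)"
      unfolding uniformly_def computable_iff n using q(1) by blast
    show "measure M (?S (q k)) \<le> (1/2) ^ k" for k
      unfolding q_eq using c_F[of k] unfolding c_def .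
    show "uniformly (\<lambda>k. computable_real_index (zero_jump (n - 1)) (measure M (?S (q k))))"
      unfolding uniformly_def computable_iff computable_real_index_def q_eq n diff_Suc_1
      using a apx(2) unfolding B_def c_def by blast
  qed
  with assms(3) have "x \<notin> (\<Inter>k. ?S (q k))" unfolding Schnorr_random_def by blast
  then show False unfolding q_eq using x_in by blast
qed

end
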